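(* For every pair of integers $k>\ell\ge 2$, \[ \operatorname{ex}(n,C_{2\ell},C_{2k})=\left(\frac{(k-1)_\ell}{2\ell}+o(1)\right)n^\ell , \] where $k,\ell$ are fixed and $o(1)\to 0$ as $n\to\infty$.
   Context: All graphs are finite and simple, and copies (subgraphs) are not required to be induced. For $r\ge 3$, $C_r$ denotes the cycle of length $r$. A graph $G$ is $F$-free if it contains no copy of $F$ as a (not necessarily induced) subgraph. For graphs $H$ and $F$, $N(H,G)$ denotes the number of unlabeled copies of $H$ in $G$ (i.e. the number of subgraphs of $G$ isomorphic to $H$), and \[ \operatorname{ex}(n,H,F)=\max\{N(H,G): |V(G)|=n \text{ and } G \text{ is } F\text{-free}\}. \] For positive integers $a,t$, $(a)_t=a(a-1)\cdots(a-t+1)$; thus $(k-1)_\ell=(k-1)(k-2)\cdots(k-\ell)$. *)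

theory Defs
  imports Complex_Main
begin

datatype 'a graph = Graph (verts: "'a set") (edges: "'a set set")

definition simple_graph :: "'a graph \<Rightarrow> bool" where
  "simple_graph G \<longleftrightarrow>
     finite (verts G) \<and> (\<forall>e\<in>edges G. e \<subseteq> verts G \<and> card e = 2)"

definition subgraph :: "'a graph \<Rightarrow> 'a graph \<Rightarrow> bool" where
  "subgraph S G \<longleftrightarrow>
     simple_graph S \<and> verts S \<subseteq> verts G \<and> edges S \<subseteq> edges G"

definition graph_iso :: "'a graph \<Rightarrow> 'b graph \<Rightarrow> bool" where
  "graph_iso G H \<longleftrightarrow>
     (\<exists>f. bij_betw f (verts G) (verts H) \<and>
          (\<forall>x\<in>verts G. \<forall>y\<in>verts G. {x, y} \<in> edges G \<longleftrightarrow> {f x, f y} \<in> edges H))"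

definition copies :: "'b graph \<Rightarrow> 'a graph \<Rightarrow> 'a graph set" where
  "copies H G = {S. subgraph S G \<and> graph_iso S H}"

definition num_copies :: "'b graph \<Rightarrow> 'a graph \<Rightarrow> nat" where
  "num_copies H G = card (copies H G)"

definition free_of :: "'b graph \<Rightarrow> 'a graph \<Rightarrow> bool" where
  "free_of F G \<longleftrightarrow> copies F G = {}"

(* Every finite graph is isomorphic to one whose vertices are natural numbers, so it is
   enough to let G range over graphs of type nat graph.  The set of counts is bounded
   (a graph on n vertices has finitely many subgraphs), and it is nonempty when F has
   an edge, because the edgeless graph on n vertices is then F-free; so Max is a genuine
   maximum. *)
definition gen_turan :: "nat \<Rightarrow> 'b graph \<Rightarrow> 'c graph \<Rightarrow> nat" where
  "gen_turan n H F =
     Max {num_copies H G | G :: nat graph.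
            simple_graph G \<and> card (verts G) = n \<and> free_of F G}"

(* The cycle of length r; meaningful only for r \<ge> 3. *)
definition cycle_graph :: "nat \<Rightarrow> nat graph" where
  "cycle_graph r = Graph {..<r} {{i, Suc i mod r} | i. i < r}"

definition falling_factorial :: "real \<Rightarrow> nat \<Rightarrow> real" where
  "falling_factorial a t = (\<Prod>i<t. a - real i)"

end

theory Submission
  imports Defs "HOL-Analysis.Convex"
begin

text \<open>
  \<^bold>\<open>Lower bound.\<close> In the complete bipartite graph with classes of sizes $k-1$ and $n-k+1$
  a cycle alternates between the classes, so a cycle of length $2k$ does not fit, while there are
  $(k-1)_\ell\,(n-k+1)_\ell/(2\ell)$ cycles of length $2\ell$.

  \<^bold>\<open>Upper bound.\<close> Let $G$ be $C_{2k}$-free on $n$ vertices; here $k \ge 3$. Call a vertex heavy if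
  its degree is at least $\varepsilon n$. The claim is that, up to a small multiple of $n^\ell$, all
  cycles of length $2\ell$ alternate between heavy and light vertices, and that the alternating
  ones are as rare as in the complete bipartite graph.

  \<^item> \<^emph>\<open>Alternating cycles.\<close> There are only boundedly many heavy vertices, hence boundedly many
    neighbourhoods (types) of light vertices inside the heavy class; light vertices of a type
    occurring fewer than $k$ times are negligible. If all light vertices of an alternating cycle
    have frequent types and $U$ is the union of these types, then the cycle can be lengthened by two
    as long as it misses a vertex $u$ of $U$: behind a light $y$ adjacent to $u$ insert $u$ and a
    fresh vertex of the type of $y$. So $|U| \ge k$ would give a $C_{2k}$; hence $|U| \le k-1$, and
    each sequence of $\ell$ light vertices has at most $(k-1)_\ell$ completions
    (\<open>support_small\<close>, \<open>card_split_cycles\<close>).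

  \<^item> \<^emph>\<open>All other cycles\<close> contain an edge inside one of the two classes. Let $A$ be the adjacency matrix
    of $G$ and $S$ that of the edges within the classes. Up to the choice of the edge, the number of
    these cycles is at most $\mathrm{tr}(S A^{2\ell-1})$, which the Cauchy--Schwarz inequality bounds by
    $\|S^2\|^{1/2}\,\|A^2\|^{\ell-1/2}$ in the Frobenius norm. Since the entries of $A^2$ are the
    codegrees, it suffices that $\sum \mathrm{codeg}^2$ is $O(n^2)$ for $G$ and at most
    $\delta^2 n^2$ for the graph of $S$, which is $C_{2k}$-free of maximum degree at most
    $\varepsilon n$ (\<open>cycles_meeting_subgraph\<close>).

  Everything is thereby reduced to two inequalities for $C_{2k}$-free graphs.

  \<^item> $\sum \mathrm{codeg}^2 \le 8k \sum \mathrm{deg}^2$ (\<open>sum_codeg_square_le\<close>). Pairs of vertices with fewer than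
    $2k$ common neighbours (thin pairs) contribute $O(\sum \mathrm{codeg}) = O(\sum \mathrm{deg}^2)$. The other
    pairs (rich pairs) behave like edges that can be subdivided in many ways, so a path on $k$
    vertices made of rich pairs inside a neighbourhood would give a $C_{2k}$; hence there are only
    linearly many rich pairs inside a neighbourhood.

  \<^item> $\sum \mathrm{deg}^2 \le 4kn\Delta + O(n^{11/6})$ for graphs of maximum degree $\Delta$
    (\<open>sum_deg_square_real\<close>). For $D \ge C\sqrt n$ at most $2kn/D$ vertices have degree at least $D$,
    because each vertex has at most $k-1$ neighbours in a set $A$ unless it is a common neighbour of a
    thin pair of $A$ (\<open>sum_deg_subset\<close>, \<open>few_high_degree\<close>). Smaller degrees
    are handled by the bound $O(n^{4/3})$ on the number of edges, which follows from the growth of the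
    first three layers around a vertex (\<open>min_degree_bound\<close>).
\<close>

section \<open>Dense subgraphs, paths and cycles as lists\<close>

text \<open>
  Edges are counted as ordered pairs throughout, so that their number is the sum of the degrees.
\<close>
definition adjacent_pairs :: "('a \<Rightarrow> 'a \<Rightarrow> bool) \<Rightarrow> 'a set \<Rightarrow> ('a \<times> 'a) set" where
  "adjacent_pairs R S = {(x, y). x \<in> S \<and> y \<in> S \<and> R x y}"

lemma adjacent_pairs_finite: "finite S \<Longrightarrow> finite (adjacent_pairs R S)"
  by (rule finite_subset[of _ "S \<times> S"]) (auto simp: adjacent_pairs_def)

text \<open>
  Deleting a vertex with at most $c$ neighbours loses at most $2c$ ordered pairs, so the density
  survives until no such vertex is left.
\<close>
lemma dense_core:
  assumes "finite S" and sym: "\<And>x y. R x y \<Longrightarrow> R y x"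
    and "card (adjacent_pairs R S) > 2 * c * card S"
  shows "\<exists>W\<subseteq>S. W \<noteq> {} \<and> (\<forall>x\<in>W. c < card {y \<in> W. R x y})"
  using assms(1,3)
proof (induction S rule: finite_psubset_induct)
  case (psubset S)
  show ?case
  proof (cases "\<forall>x\<in>S. c < card {y \<in> S. R x y}")
    case True
    have "S \<noteq> {}" using psubset.prems by (auto simp: adjacent_pairs_def)
    with True show ?thesis by blast
  next
    case False
    then obtain x where x: "x \<in> S" "card {y \<in> S. R x y} \<le> c" by auto
    let ?T = "S - {x}" and ?B = "{y \<in> S. R x y}"
    have "adjacent_pairs R S \<subseteq> adjacent_pairs R ?T \<union> (Pair x ` ?B \<union> (\<lambda>y. (y, x)) ` ?B)"
    proof
      fix z assume z: "z \<in> adjacent_pairs R S"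
      obtain a b where ab: "z = (a, b)" by (cases z)
      with z have *: "a \<in> S" "b \<in> S" "R a b" "R b a" using sym[of a b] by (auto simp: adjacent_pairs_def)
      show "z \<in> adjacent_pairs R ?T \<union> (Pair x ` ?B \<union> (\<lambda>y. (y, x)) ` ?B)"
        using * by (cases "a = x"; cases "b = x") (auto simp: ab adjacent_pairs_def)
    qed
    then have "card (adjacent_pairs R S) \<le> card (adjacent_pairs R ?T \<union> (Pair x ` ?B \<union> (\<lambda>y. (y, x)) ` ?B))"
      using psubset.hyps by (intro card_mono) (auto simp: adjacent_pairs_finite)
    also have "\<dots> \<le> card (adjacent_pairs R ?T) + card (Pair x ` ?B \<union> (\<lambda>y. (y, x)) ` ?B)"
      by (rule card_Un_le)
    also have "card (Pair x ` ?B \<union> (\<lambda>y. (y, x)) ` ?B) \<le> card (Pair x ` ?B) + card ((\<lambda>y. (y, x)) ` ?B)"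
      by (rule card_Un_le)
    also have "\<dots> \<le> card ?B + card ?B"
      using psubset.hyps by (intro add_mono card_image_le) auto
    finally have "card (adjacent_pairs R S) \<le> card (adjacent_pairs R ?T) + 2 * c"
      using x(2) by simp
    moreover have "card S = Suc (card ?T)"
      by (rule card.remove[OF psubset.hyps x(1)])
    ultimately have dense: "card (adjacent_pairs R ?T) > 2 * c * card ?T"
      using psubset.prems by simp
    have "?T \<subset> S" using x(1) by auto
    from psubset.IH[OF this dense] show ?thesis by (meson Diff_subset subset_trans)
  qed
qed

text \<open>
  Greedy extension; the set \<open>Q\<close> collects the forbidden vertices, in particular those already used.
\<close>
lemma path_in_core:
  assumes "\<And>x. x \<in> W \<Longrightarrow> c < card {y \<in> W. R x y}"
    and "x \<in> W" "finite Q" "x \<notin> Q" "card Q + j \<le> c"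
  shows "\<exists>p. distinct p \<and> length p = Suc j \<and> hd p = x \<and> set p \<subseteq> W \<and> set p \<inter> Q = {} \<and> successively R p"
  using assms(2-)
proof (induction j arbitrary: x Q)
  case 0
  then show ?case by (intro exI[of _ "[x]"]) auto
next
  case (Suc j)
  have "card (insert x Q) < card {y \<in> W. R x y}"
    using assms(1)[OF Suc.prems(1)] Suc.prems by (simp add: card_insert_if)
  then have "\<not> {y \<in> W. R x y} \<subseteq> insert x Q"
    using Suc.prems(2) by (meson card_mono finite_insert not_le)
  then obtain y where y: "y \<in> W" "R x y" "y \<notin> insert x Q" by auto
  have "card (insert x Q) + j \<le> c"
    using Suc.prems by (simp add: card_insert_if)
  then obtain p where p: "distinct p" "length p = Suc j" "hd p = y" "set p \<subseteq> W"
      "set p \<inter> insert x Q = {}" "successively R p"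
    using Suc.IH[OF y(1), of "insert x Q"] y(3) Suc.prems(2) by auto
  have "p \<noteq> []" using p(2) by auto
  with p y Suc.prems show ?case
    by (intro exI[of _ "x # p"]) (auto simp: successively_Cons)
qed

text \<open>
  Serves as a substitute for bipartiteness: the property \<open>X\<close> is only assumed to be inherited over two
  steps, which covers relations inside \<open>X\<close> as well as those between \<open>X\<close> and a disjoint set.
\<close>
lemma last_of_odd_walk:
  assumes step: "\<And>u v w. u \<in> W \<Longrightarrow> v \<in> W \<Longrightarrow> w \<in> W \<Longrightarrow> R u v \<Longrightarrow> R v w \<Longrightarrow> u \<in> X \<Longrightarrow> w \<in> X"
    and "successively R p" "set p \<subseteq> W" "odd (length p)" "hd p \<in> X"
  shows "last p \<in> X"
  using assms(2-)
proof (induction p rule: induct_list012)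
  case (3 u v q)
  then have "q \<noteq> []" by auto
  then obtain w q' where q: "q = w # q'" by (cases q) auto
  have "w \<in> X" using 3 q step[of u v w] by simp
  with 3 q show ?case by simp
qed auto

text \<open>
  A cycle with a chosen starting point and orientation.
\<close>
definition cycle_list :: "('a \<Rightarrow> 'a \<Rightarrow> bool) \<Rightarrow> 'a list \<Rightarrow> bool" where
  "cycle_list E p \<longleftrightarrow> p \<noteq> [] \<and> distinct p \<and> successively E (p @ [hd p])"

lemma cycle_list_Cons:
  assumes "p \<noteq> []"
  shows "cycle_list E (x # p) \<longleftrightarrow> x \<notin> set p \<and> distinct p \<and> successively E p \<and> E x (hd p) \<and> E (last p) x"
  using assms by (auto simp: cycle_list_def successively_Cons successively_append_iff)

lemma cycle_list_rotate1:
  assumes "cycle_list E p" shows "cycle_list E (rotate1 p)"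
proof (cases p)
  case (Cons x q)
  show ?thesis
  proof (cases "q = []")
    case False
    then show ?thesis using assms Cons
      by (auto simp: cycle_list_def successively_Cons successively_append_iff hd_append)
  qed (use assms Cons in auto)
qed (use assms in auto)

lemma cycle_list_rotate: "cycle_list E p \<Longrightarrow> cycle_list E (rotate i p)"
  by (induction i) (auto intro: cycle_list_rotate1)

lemma cycle_list_mono:
  "cycle_list E p \<Longrightarrow> (\<And>x y. E x y \<Longrightarrow> E' x y) \<Longrightarrow> cycle_list E' p"
  unfolding cycle_list_def by (auto intro: successively_mono)

locale fin_graph =
  fixes V :: "'a set" and E :: "'a \<Rightarrow> 'a \<Rightarrow> bool"
  assumes finite_verts: "finite V"
    and adj_sym: "E x y \<Longrightarrow> E y x"
    and adj_irrefl: "\<not> E x x"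
    and adj_verts: "E x y \<Longrightarrow> x \<in> V"
begin

definition nbrs :: "'a \<Rightarrow> 'a set" where "nbrs x = {y. E x y}"

definition deg :: "'a \<Rightarrow> nat" where "deg x = card (nbrs x)"

definition codeg :: "'a \<Rightarrow> 'a \<Rightarrow> nat" where "codeg x y = card (nbrs x \<inter> nbrs y)"

lemma nbrs_subset: "nbrs x \<subseteq> V"
  using adj_sym adj_verts unfolding nbrs_def by blast

lemma finite_nbrs [simp]: "finite (nbrs x)"
  using nbrs_subset finite_verts finite_subset by blast

lemma in_nbrs [simp]: "y \<in> nbrs x \<longleftrightarrow> E x y"
  by (simp add: nbrs_def)

lemma adj_verts': "E x y \<Longrightarrow> y \<in> V"
  using adj_sym adj_verts by blast

end

locale cycle_free_graph = fin_graph +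
  fixes k :: nat
  assumes k_ge: "k \<ge> 3"
    and no_cycle: "cycle_list E p \<Longrightarrow> length p \<noteq> 2 * k"
begin

text \<open>
  A path on $2k-1$ vertices whose ends are both adjacent to \<open>r\<close> closes to a $C_{2k}$ through \<open>r\<close>.
  Such a path exists in any dense core, since paths of even length return to \<open>X\<close>.
\<close>
lemma apex_bound:
  assumes W: "finite W" "r \<notin> W"
    and X: "\<And>x. x \<in> X \<Longrightarrow> E r x"
    and R: "\<And>x y. R x y \<Longrightarrow> R y x" "\<And>x y. R x y \<Longrightarrow> E x y" "\<And>x y. R x y \<Longrightarrow> x \<in> X \<or> y \<in> X"
    and step: "\<And>u v w. R u v \<Longrightarrow> R v w \<Longrightarrow> u \<in> X \<Longrightarrow> w \<in> X"
  shows "card (adjacent_pairs R W) \<le> 4 * k * card W"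
proof (rule ccontr)
  assume "\<not> ?thesis"
  then have "card (adjacent_pairs R W) > 2 * (2 * k) * card W" by simp
  from dense_core[of W R, OF W(1) R(1) this]
  obtain W' where W': "W' \<subseteq> W" "W' \<noteq> {}" "\<forall>x\<in>W'. 2 * k < card {y \<in> W'. R x y}" by blast
  have nbr: "\<exists>y\<in>W'. R x y" if "x \<in> W'" for x
  proof (rule ccontr)
    assume "\<not> ?thesis"
    then have "{y \<in> W'. R x y} = {}" by auto
    then have "card {y \<in> W'. R x y} = 0" by (simp only: card.empty)
    with W'(3) that show False by fastforce
  qed
  obtain x where x: "x \<in> W'" "x \<in> X" using W'(2) nbr R(3) by blast
  obtain p where p: "distinct p" "length p = Suc (2 * k - 2)" "hd p = x" "set p \<subseteq> W'" "successively R p"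
    using path_in_core[of W' "2 * k" R x "{}" "2 * k - 2"] W'(3) x by auto
  have ne: "p \<noteq> []" using p(2) by auto
  have "last p \<in> X"
    using step by (rule last_of_odd_walk[of W' R X p]) (use p x k_ge in auto)
  then have "E (last p) r" using X adj_sym by blast
  moreover have "successively E p" by (rule successively_mono[OF p(5) R(2)])
  moreover have "E r (hd p)" using X x(2) p(3) by simp
  moreover have "r \<notin> set p" using p(4) W'(1) W(2) by blast
  ultimately have "cycle_list E (r # p)"
    using ne p(1) by (simp add: cycle_list_Cons)
  then have "length (r # p) \<noteq> 2 * k" by (rule no_cycle)
  then show False using p(2) k_ge by simp
qed

text \<open>
  The same linear bound one layer further out: every vertex of \<open>Y\<close> has a parent \<open>c y\<close> adjacent to \<open>r\<close>.
  Consider a dense core. If some vertex $t$ has neighbours $z$, $z'$ with different parents, a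
  path leaves $t$ through a third neighbour and ends in \<open>Y\<close> at $w$; one of $z$, $z'$ has a parent
  different from that of $w$, and the cycle closes through the two parents and \<open>r\<close>. Otherwise parents
  are constant along paths, taken at every second vertex, and a path closes through a single parent.
\<close>
lemma coloured_bound:
  assumes W: "finite W" "r \<notin> W"
    and c: "\<And>y. y \<in> Y \<Longrightarrow> E y (c y)" "\<And>y. y \<in> Y \<Longrightarrow> E r (c y)" "\<And>y. y \<in> Y \<Longrightarrow> c y \<notin> W"
    and R: "\<And>x y. R x y \<Longrightarrow> R y x" "\<And>x y. R x y \<Longrightarrow> E x y" "\<And>x y. R x y \<Longrightarrow> x \<in> Y \<or> y \<in> Y"
    and step: "\<And>u v w. R u v \<Longrightarrow> R v w \<Longrightarrow> u \<in> Y \<Longrightarrow> w \<in> Y"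
  shows "card (adjacent_pairs R W) \<le> 4 * k * card W"
proof (rule ccontr)
  assume "\<not> ?thesis"
  then have "card (adjacent_pairs R W) > 2 * (2 * k) * card W" by simp
  from dense_core[of W R, OF W(1) R(1) this]
  obtain W' where W': "W' \<subseteq> W" "W' \<noteq> {}" "\<forall>x\<in>W'. 2 * k < card {y \<in> W'. R x y}" by blast
  have many: "\<exists>y\<in>W'. R x y \<and> y \<notin> Q" if "x \<in> W'" "finite Q" "card Q \<le> 2 * k" for x Q
  proof (rule ccontr)
    assume "\<not> ?thesis"
    then have "{y \<in> W'. R x y} \<subseteq> Q" by auto
    then have "card {y \<in> W'. R x y} \<le> card Q" using that card_mono by blast
    with W'(3) that show False by force
  qed
  show False
  proof (cases "\<exists>t\<in>W'. \<exists>z\<in>W' \<inter> Y. \<exists>z'\<in>W' \<inter> Y. R t z \<and> R t z' \<and> c z \<noteq> c z'")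
    case True
    then obtain t z z' where t: "t \<in> W'" "z \<in> W'" "z' \<in> W'" "z \<in> Y" "z' \<in> Y" "R t z" "R t z'" "c z \<noteq> c z'"
      by blast
    \<comment> \<open>A path on $2k-5$ vertices together with \<open>r\<close>, two parents, \<open>t\<close> and one of \<open>z\<close>, \<open>z'\<close> has $2k$ vertices.\<close>
    have "card {z, z', t} \<le> 3" by (simp add: card_insert_if)
    then obtain z'' where z'': "z'' \<in> W'" "R t z''" "z'' \<notin> {z, z', t}"
      using many[OF t(1), of "{z, z', t}"] k_ge by auto
    have zY: "z'' \<in> Y" using step[OF R(1)[OF t(6)] z''(2)] t(4) by simp
    obtain p where p: "distinct p" "length p = Suc (2 * k - 6)" "hd p = z''" "set p \<subseteq> W'"
        "set p \<inter> {z, z', t} = {}" "successively R p"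
    proof -
      have "card {z, z', t} + (2 * k - 6) \<le> 2 * k" using \<open>card {z, z', t} \<le> 3\<close> k_ge by linarith
      then show ?thesis
        using path_in_core[of W' "2 * k" R z'' "{z, z', t}" "2 * k - 6"] W'(3) z''(1,3) that by auto
    qed
    have ne: "p \<noteq> []" using p(2) by auto
    have lY: "last p \<in> Y"
      using step by (rule last_of_odd_walk[of W' R Y p]) (use p zY k_ge in auto)
    obtain z0 where z0: "z0 \<in> {z, z'}" "c z0 \<noteq> c (last p)" using t(8) by (metis insertCI)
    have sp: "successively E p" by (rule successively_mono[OF p(6) R(2)])
    have z0': "z0 \<in> W'" "z0 \<in> Y" "R t z0" "z0 \<notin> set p" using z0(1) t p(5) by auto
    have "z0 \<noteq> t" using z0'(3) R(2) adj_irrefl by blast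
    have adj: "E z0 t" "E t z''" "E r (c z0)" "E (c z0) z0" "E (last p) (c (last p))" "E (c (last p)) r"
      using R(2)[OF R(1)[OF z0'(3)]] R(2)[OF z''(2)] c(2)[OF z0'(2)] adj_sym[OF c(1)[OF z0'(2)]]
        c(1)[OF lY] adj_sym[OF c(2)[OF lY]] by simp_all
    have "set p \<subseteq> W" using p(4) W'(1) by blast
    moreover have "t \<in> W" "z0 \<in> W" using t(1) z0'(1) W'(1) by blast+
    moreover have "c z0 \<noteq> r" "c (last p) \<noteq> r" using adj(3,6) adj_irrefl[of r] by metis+
    moreover have "c z0 \<notin> W" "c (last p) \<notin> W" using c(3)[OF z0'(2)] c(3)[OF lY] .
    moreover have "r \<noteq> v \<and> c z0 \<noteq> v \<and> c (last p) \<noteq> v" if "v \<in> W" for v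
      using that W(2) calculation by metis
    ultimately have "distinct (r # c z0 # z0 # t # p @ [c (last p)])"
      using p(1,5) z0'(4) \<open>z0 \<noteq> t\<close> z0(2) by (simp add: subset_iff) metis
    then have "cycle_list E (r # c z0 # z0 # t # p @ [c (last p)])"
      using ne sp p(3) adj by (simp add: cycle_list_def successively_Cons successively_append_iff)
    then have "length (r # c z0 # z0 # t # p @ [c (last p)]) \<noteq> 2 * k" by (rule no_cycle)
    then show False using p(2) k_ge by simp
  next
    case False
    have mono: "c z = c z'" if "t \<in> W'" "z \<in> W'" "z' \<in> W'" "z \<in> Y" "z' \<in> Y" "R t z" "R t z'" for t z z'
    proof (rule ccontr)
      assume "c z \<noteq> c z'"
      moreover have "z \<in> W' \<inter> Y" "z' \<in> W' \<inter> Y" using that by blast+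
      ultimately show False using that(1,6,7) False by meson
    qed
    obtain x where x: "x \<in> W'" using W'(2) by blast
    obtain x' where "x' \<in> W'" "R x x'" using many[OF x, of "{}"] by auto
    then obtain y where y: "y \<in> W'" "y \<in> Y" using R(3)[of x x'] x by blast
    obtain p where p: "distinct p" "length p = Suc (2 * k - 2)" "hd p = y" "set p \<subseteq> W'" "successively R p"
      using path_in_core[of W' "2 * k" R y "{}" "2 * k - 2"] W'(3) y by auto
    have ne: "p \<noteq> []" using p(2) by auto
    have "last p \<in> {z \<in> Y. c z = c y}"
    proof (rule last_of_odd_walk[of W' R _ p])
      fix u v w
      assume a: "u \<in> W'" "v \<in> W'" "w \<in> W'" "R u v" "R v w" "u \<in> {z \<in> Y. c z = c y}"
      then have "w \<in> Y" using step by blast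
      moreover have "R v u" using R(1) a(4) by blast
      moreover have "u \<in> Y" using a(6) by simp
      ultimately have "c w = c u" using mono[OF a(2,3,1)] a(5) by blast
      with a(6) \<open>w \<in> Y\<close> show "w \<in> {z \<in> Y. c z = c y}" by simp
    qed (use p y k_ge in auto)
    then have "last p \<in> Y" "c (last p) = c y" by auto
    then have "E (last p) (c y)" using c(1)[of "last p"] by simp
    moreover have "successively E p" by (rule successively_mono[OF p(5) R(2)])
    moreover have "E (c y) (hd p)" using c(1)[OF y(2)] p(3) adj_sym by simp
    moreover have "c y \<notin> set p" using p(4) W'(1) c(3)[OF y(2)] by blast
    ultimately have "cycle_list E (c y # p)"
      using ne p(1) by (simp add: cycle_list_Cons)
    then have "length (c y # p) \<noteq> 2 * k" by (rule no_cycle)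
    then show False using p(2) k_ge by simp
  qed
qed

end

section \<open>The number of edges, and rich pairs\<close>

context fin_graph
begin

lemma deg_le: "deg x \<le> card V"
  unfolding deg_def by (rule card_mono[OF finite_verts nbrs_subset])

lemma codeg_sym: "codeg x y = codeg y x"
  by (simp add: codeg_def Int_commute)

lemma sum_deg_eq:
  assumes "A \<subseteq> V"
  shows "(\<Sum>a\<in>A. deg a) = card {(a, b). a \<in> A \<and> E a b}"
proof -
  have "{(a, b). a \<in> A \<and> E a b} = Sigma A nbrs" by auto
  then show ?thesis
    using finite_subset[OF assms finite_verts] by (simp add: deg_def)
qed

text \<open>
  Both sides count the walks with two edges, the left one by their ends and the right one by their
  midpoints.
\<close>
lemma sum_codeg_eq: "(\<Sum>(u, v)\<in>V \<times> V. codeg u v) = (\<Sum>w\<in>V. (deg w)\<^sup>2)"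
proof -
  have "(\<Sum>(u, v)\<in>V \<times> V. codeg u v) = (\<Sum>p\<in>V \<times> V. card {w \<in> V. E (fst p) w \<and> E (snd p) w})"
  proof (rule sum.cong)
    fix p assume "p \<in> V \<times> V"
    obtain u v where p: "p = (u, v)" by (cases p)
    have "nbrs u \<inter> nbrs v = {w \<in> V. E u w \<and> E v w}"
      using nbrs_subset by auto
    then show "(case p of (u, v) \<Rightarrow> codeg u v) = card {w \<in> V. E (fst p) w \<and> E (snd p) w}"
      by (simp add: codeg_def p)
  qed simp
  also have "\<dots> = (\<Sum>w\<in>V. (deg w)\<^sup>2)"
  proof (rule sum_multicount_gen)
    show "\<forall>w\<in>V. card {p \<in> V \<times> V. E (fst p) w \<and> E (snd p) w} = (deg w)\<^sup>2"
    proof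
      fix w assume "w \<in> V"
      have "{p \<in> V \<times> V. E (fst p) w \<and> E (snd p) w} = nbrs w \<times> nbrs w"
        using adj_sym adj_verts by (auto simp: nbrs_def) 
      then show "card {p \<in> V \<times> V. E (fst p) w \<and> E (snd p) w} = (deg w)\<^sup>2"
        by (simp add: deg_def card_cartesian_product power2_eq_square)
    qed
  qed (use finite_verts in auto)
  finally show ?thesis .
qed

end

context cycle_free_graph
begin

text \<open>
  Let \<open>X\<close> be the neighbourhood of a vertex and \<open>Y\<close> the set of vertices at distance two. The
  linear bounds of the two preceding lemmas say that \<open>X\<close> can only absorb its $d|X|$ edges if
  $|Y| = \Omega(d^2)$, and that \<open>Y\<close> can only absorb its $d|Y|$ edges if $d|Y| = O(n)$.
\<close>
lemma min_degree_bound: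
  assumes "V \<noteq> {}" and deg: "\<And>x. x \<in> V \<Longrightarrow> d \<le> deg x"
  shows "d ^ 3 \<le> (18 * k) ^ 3 * card V"
proof (cases "d \<le> 18 * k")
  case True
  then have "d ^ 3 \<le> (18 * k) ^ 3" by (rule power_mono) simp
  moreover have "1 \<le> card V" using assms(1) finite_verts by (simp add: Suc_le_eq card_gt_0_iff)
  ultimately show ?thesis by (metis mult.right_neutral mult_le_mono)
next
  case False
  then have d: "18 * k < d" by simp
  obtain r where r: "r \<in> V" using assms(1) by blast
  define X where "X = nbrs r"
  define W where "W = V - X - {r}"
  define Y where "Y = {y \<in> W. \<exists>x\<in>X. E x y}"
  define c where "c y = (SOME x. x \<in> X \<and> E x y)" for y
  have c: "c y \<in> X \<and> E (c y) y" if "y \<in> Y" for y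
    unfolding c_def by (rule someI_ex) (use that in \<open>auto simp: Y_def\<close>)
  have XV: "X \<subseteq> V" "r \<notin> X" using nbrs_subset adj_irrefl by (auto simp: X_def)
  have YW: "Y \<subseteq> W" "W \<subseteq> V" "X \<inter> W = {}" "r \<notin> W" by (auto simp: Y_def W_def)
  have fin: "finite X" "finite Y" "finite W" "finite (X \<union> Y)"
    using finite_subset[OF XV(1) finite_verts] finite_subset[OF YW(2) finite_verts]
      finite_subset[OF YW(1)] by auto
  \<comment> \<open>The edges at \<open>X\<close> and at \<open>Y\<close>, apart from those at \<open>r\<close>, sorted by the layers they join.\<close>
  define R1 where "R1 = (\<lambda>x y. E x y \<and> x \<in> X \<and> y \<in> X)"
  define R2 where "R2 = (\<lambda>x y. E x y \<and> (x \<in> X \<and> y \<in> Y \<or> x \<in> Y \<and> y \<in> X))"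
  define R3 where "R3 = (\<lambda>x y. E x y \<and> x \<in> Y \<and> y \<in> Y)"
  define R4 where "R4 = (\<lambda>x y. E x y \<and> (x \<in> Y \<and> y \<in> W - Y \<or> x \<in> W - Y \<and> y \<in> Y))"
  have X: "E r x" if "x \<in> X" for x using that by (simp add: X_def)
  have b1: "card (adjacent_pairs R1 X) \<le> 4 * k * card X"
    by (rule apex_bound[OF fin(1) XV(2) X]) (auto simp: R1_def intro: adj_sym)
  have b2: "card (adjacent_pairs R2 (X \<union> Y)) \<le> 4 * k * card (X \<union> Y)"
    by (rule apex_bound[OF fin(4) _ X]) (use XV(2) YW in \<open>auto simp: R2_def intro: adj_sym\<close>)
  have cY: "E y (c y)" "E r (c y)" "c y \<notin> W" if "y \<in> Y" for y
    using c[OF that] YW(3) X adj_sym by blast+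
  have cY': "c y \<notin> Y" if "y \<in> Y" for y using cY(3)[OF that] YW(1) by blast
  have rY: "r \<notin> Y" using YW by blast
  have b3: "card (adjacent_pairs R3 Y) \<le> 4 * k * card Y"
    by (rule coloured_bound[OF fin(2) rY cY(1,2) cY']) (auto simp: R3_def intro: adj_sym)
  have b4: "card (adjacent_pairs R4 W) \<le> 4 * k * card W"
    by (rule coloured_bound[OF fin(3) YW(4) cY]) (auto simp: R4_def intro: adj_sym)
  have cX: "d \<le> card X" using deg[OF r] by (simp add: X_def deg_def)
  have cXY: "card (X \<union> Y) \<le> card X + card Y" by (rule card_Un_le)
  have cXY': "card (X \<union> Y) \<le> card V" "card Y \<le> card V" "card W \<le> card V"
    using XV YW finite_verts by (auto intro!: card_mono)
  have "d * card X \<le> (\<Sum>x\<in>X. deg x)"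
    using sum_bounded_below[of X d deg] deg XV(1) by (auto simp: mult.commute)
  also have "\<dots> = card {(a, b). a \<in> X \<and> E a b}" by (rule sum_deg_eq[OF XV(1)])
  also have "\<dots> \<le> card ((X \<times> {r}) \<union> (adjacent_pairs R1 X \<union> adjacent_pairs R2 (X \<union> Y)))"
  proof (rule card_mono)
    show "{(a, b). a \<in> X \<and> E a b} \<subseteq> X \<times> {r} \<union> (adjacent_pairs R1 X \<union> adjacent_pairs R2 (X \<union> Y))"
    proof (rule subsetI, rule ccontr)
      fix e assume e: "e \<in> {(a, b). a \<in> X \<and> E a b}"
        and no: "e \<notin> X \<times> {r} \<union> (adjacent_pairs R1 X \<union> adjacent_pairs R2 (X \<union> Y))"
      obtain a b where ab: "e = (a, b)" "a \<in> X" "E a b" using e by blast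
      have "b \<notin> X" using no ab by (auto simp: adjacent_pairs_def R1_def)
      moreover have "b \<notin> Y" using no ab by (auto simp: adjacent_pairs_def R2_def)
      moreover have "b \<in> V" using ab adj_verts' by blast
      ultimately have "b = r" using ab adj_sym[of a b] by (auto simp: Y_def W_def)
      then show False using no ab by simp
    qed
  qed (use fin in \<open>auto simp: adjacent_pairs_finite\<close>)
  also have "\<dots> \<le> card (X \<times> {r}) + (card (adjacent_pairs R1 X) + card (adjacent_pairs R2 (X \<union> Y)))"
    by (meson add_left_mono card_Un_le order_trans)
  also have "\<dots> \<le> card X + (4 * k * card X + 4 * k * (card X + card Y))"
    using b1 order_trans[OF b2 mult_le_mono2[OF cXY]] by (simp add: card_cartesian_product)
  also have "\<dots> \<le> 9 * k * card X + 4 * k * card Y"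
  proof -
    have "card X \<le> k * card X" using k_ge by simp
    then show ?thesis by (simp add: algebra_simps)
  qed
  finally have "2 * (d * card X) \<le> 18 * k * card X + 8 * k * card Y" by simp
  moreover have "18 * k * card X \<le> d * card X" using d by simp
  ultimately have "d * card X \<le> 8 * k * card Y" by linarith
  with cX have dY: "d * d \<le> 8 * k * card Y" by (meson le_trans mult_le_mono2)
  have "d * card Y \<le> (\<Sum>x\<in>Y. deg x)"
    using sum_bounded_below[of Y d deg] deg YW by (auto simp: mult.commute subset_iff)
  also have "\<dots> = card {(a, b). a \<in> Y \<and> E a b}" by (rule sum_deg_eq) (use YW in blast)
  also have "\<dots> \<le> card (adjacent_pairs R2 (X \<union> Y) \<union> (adjacent_pairs R3 Y \<union> adjacent_pairs R4 W))"
  proof (rule card_mono)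
    show "{(a, b). a \<in> Y \<and> E a b} \<subseteq> adjacent_pairs R2 (X \<union> Y) \<union> (adjacent_pairs R3 Y \<union> adjacent_pairs R4 W)"
    proof (rule subsetI, rule ccontr)
      fix e assume e: "e \<in> {(a, b). a \<in> Y \<and> E a b}"
        and no: "e \<notin> adjacent_pairs R2 (X \<union> Y) \<union> (adjacent_pairs R3 Y \<union> adjacent_pairs R4 W)"
      obtain a b where ab: "e = (a, b)" "a \<in> Y" "E a b" using e by blast
      have "a \<notin> X" "a \<in> W" using ab(2) YW by blast+
      moreover have "b \<notin> Y" using no ab by (auto simp: adjacent_pairs_def R3_def)
      moreover have "b \<noteq> r" using ab(3) adj_sym[of a b] \<open>a \<notin> X\<close> by (auto simp: X_def)
      moreover have "b \<in> V" using ab adj_verts' by blast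
      ultimately have "b \<in> X" using no ab by (auto simp: adjacent_pairs_def R4_def W_def)
      then show False using no ab by (auto simp: adjacent_pairs_def R2_def)
    qed
  qed (use fin in \<open>auto simp: adjacent_pairs_finite\<close>)
  also have "\<dots> \<le> card (adjacent_pairs R2 (X \<union> Y)) + (card (adjacent_pairs R3 Y) + card (adjacent_pairs R4 W))"
    by (meson add_left_mono card_Un_le order_trans)
  also have "\<dots> \<le> 4 * k * card V + (4 * k * card V + 4 * k * card V)"
    using order_trans[OF b2 mult_le_mono2[OF cXY'(1)]] order_trans[OF b3 mult_le_mono2[OF cXY'(2)]]
      order_trans[OF b4 mult_le_mono2[OF cXY'(3)]] by linarith
  finally have "d * card Y \<le> 12 * k * card V" by simp
  have "d ^ 3 \<le> 8 * k * card Y * d" using mult_le_mono1[OF dY, of d] by (simp add: power3_eq_cube)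
  also have "\<dots> = 8 * k * (d * card Y)" by simp
  also have "\<dots> \<le> 8 * k * (12 * k * card V)" by (rule mult_le_mono2) fact
  also have "\<dots> \<le> (18 * k) ^ 3 * card V"
    using k_ge by (simp add: power3_eq_cube)
  finally show ?thesis .
qed

lemma induced_subgraph:
  assumes "W \<subseteq> V"
  shows "cycle_free_graph W (\<lambda>x y. E x y \<and> x \<in> W \<and> y \<in> W) k"
proof
  show "finite W" using assms finite_verts by (rule finite_subset)
  fix p assume "cycle_list (\<lambda>x y. E x y \<and> x \<in> W \<and> y \<in> W) p"
  then have "cycle_list E p" by (rule cycle_list_mono) simp
  then show "length p \<noteq> 2 * k" by (rule no_cycle)
qed (use adj_sym adj_irrefl k_ge in auto)

text \<open>
  If there were more edges, a dense core would contradict the bound on the minimum degree.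
\<close>
lemma sum_deg_le:
  assumes "(18 * k) ^ 3 * card V < (Suc c) ^ 3"
  shows "(\<Sum>v\<in>V. deg v) \<le> 2 * c * card V"
proof (rule ccontr)
  assume "\<not> ?thesis"
  moreover have "{(a, b). a \<in> V \<and> E a b} = adjacent_pairs E V"
    using adj_verts' by (auto simp: adjacent_pairs_def)
  ultimately have "card (adjacent_pairs E V) > 2 * c * card V"
    by (simp add: sum_deg_eq)
  from dense_core[OF finite_verts adj_sym this]
  obtain W where W: "W \<subseteq> V" "W \<noteq> {}" "\<forall>x\<in>W. c < card {y \<in> W. E x y}" by blast
  interpret S: cycle_free_graph W "\<lambda>x y. E x y \<and> x \<in> W \<and> y \<in> W" k
    by (rule induced_subgraph[OF W(1)])
  have "Suc c ^ 3 \<le> (18 * k) ^ 3 * card W"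
  proof (rule S.min_degree_bound[OF W(2)])
    fix x assume x: "x \<in> W"
    then have "S.nbrs x = {y \<in> W. E x y}" by (auto simp: S.nbrs_def)
    then show "Suc c \<le> S.deg x" using W(3) x by (simp add: S.deg_def Suc_le_eq)
  qed
  also have "\<dots> \<le> (18 * k) ^ 3 * card V"
    by (rule mult_le_mono2) (rule card_mono[OF finite_verts W(1)])
  finally show False using assms by simp
qed

text \<open>
  The threshold $2k$ ensures that a common neighbour avoiding the fewer than $2k$ vertices chosen so far
  always exists when a cycle of length $2k$ is being built.
\<close>
definition rich :: "'a \<Rightarrow> 'a \<Rightarrow> bool" where
  "rich u v \<longleftrightarrow> u \<noteq> v \<and> 2 * k \<le> codeg u v"

definition thin :: "'a \<Rightarrow> 'a \<Rightarrow> bool" where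
  "thin u v \<longleftrightarrow> u \<noteq> v \<and> codeg u v < 2 * k"

lemma rich_sym: "rich u v \<Longrightarrow> rich v u"
  by (auto simp: rich_def codeg_sym)

lemma rich_common_neighbour:
  assumes "rich u v" "finite Q" "card Q < 2 * k"
  shows "\<exists>m. E u m \<and> E m v \<and> m \<notin> Q"
proof -
  have "card Q < card (nbrs u \<inter> nbrs v)" using assms by (simp add: rich_def codeg_def)
  then have "\<not> nbrs u \<inter> nbrs v \<subseteq> Q" using assms(2) by (meson card_mono not_le)
  then obtain m where "m \<in> nbrs u \<inter> nbrs v" "m \<notin> Q" by blast
  then have "E u m" "E v m" by simp_all
  then show ?thesis using adj_sym \<open>m \<notin> Q\<close> by blast
qed

text \<open>
  The common neighbours are chosen one after the other; the bound on the sizes leaves room for one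
  that avoids \<open>Q\<close> and all vertices of the path.
\<close>
lemma subdivide_rich_path:
  assumes "ws \<noteq> []" "distinct ws" "successively rich ws" "finite Q" "set ws \<inter> Q = {}"
    and "card Q + 2 * length ws \<le> 2 * k + 1"
  shows "\<exists>q. distinct q \<and> successively E q \<and> hd q = hd ws \<and> last q = last ws \<and>
      length q = 2 * length ws - 1 \<and> set q \<inter> Q = {}"
  using assms
proof (induction ws arbitrary: Q)
  case (Cons w ws)
  show ?case
  proof (cases "ws = []")
    case True
    then show ?thesis using Cons.prems by (intro exI[of _ "[w]"]) auto
  next
    case False
    have cQ: "card (insert w Q) = Suc (card Q)" using Cons.prems by simp
    have "\<exists>q. distinct q \<and> successively E q \<and> hd q = hd ws \<and> last q = last ws \<and>
      length q = 2 * length ws - 1 \<and> set q \<inter> insert w Q = {}"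
      by (rule Cons.IH) (use False Cons.prems cQ in \<open>auto simp: successively_Cons\<close>)
    then obtain q where q: "distinct q" "successively E q" "hd q = hd ws" "last q = last ws"
      "length q = 2 * length ws - 1" "set q \<inter> insert w Q = {}" by blast
    have l: "length ws \<ge> 1" using False by (cases ws) auto
    then have ne: "q \<noteq> []" using q(5) by auto
    have "card (Q \<union> insert w (set q)) \<le> card Q + card (insert w (set q))" by (rule card_Un_le)
    also have "\<dots> \<le> card Q + Suc (length q)" using card_length[of q] by (simp add: card_insert_if)
    also have "\<dots> < 2 * k" using q(5) Cons.prems(6) l by simp
    finally have "card (Q \<union> insert w (set q)) < 2 * k" .
    moreover have "rich w (hd ws)" using Cons.prems(3) False by (simp add: successively_Cons)
    ultimately obtain m where m: "E w m" "E m (hd ws)" "m \<notin> Q \<union> insert w (set q)"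
      using rich_common_neighbour[of w "hd ws" "Q \<union> insert w (set q)"] Cons.prems(4) by auto
    show ?thesis
      using q m ne l False Cons.prems
      by (intro exI[of _ "w # m # q"]) (auto simp: successively_Cons)
  qed
qed simp

text \<open>
  A cycle through $k$ vertices of the clique, subdivided at every pair, is a $C_{2k}$.
\<close>
lemma no_rich_clique:
  assumes "finite I" "\<And>u v. u \<in> I \<Longrightarrow> v \<in> I \<Longrightarrow> u \<noteq> v \<Longrightarrow> rich u v"
  shows "card I < k"
proof (rule ccontr)
  assume "\<not> ?thesis"
  then obtain J where J: "J \<subseteq> I" "card J = k" "finite J"
    by (metis not_less obtain_subset_with_card_n)
  obtain ws where ws: "set ws = J" "distinct ws" using finite_distinct_list[OF J(3)] by blast
  have len: "length ws = k" using ws J(2) distinct_card by fastforce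
  then have ne: "ws \<noteq> []" using k_ge by auto
  have "successively rich ws"
    using ws(2) len unfolding successively_conv_nth
    by (intro allI impI assms(2)) (use ws J(1) in \<open>auto simp: nth_eq_iff_index_eq\<close>)
  then obtain q where q: "distinct q" "successively E q" "hd q = hd ws" "last q = last ws" "length q = 2 * k - 1"
    using subdivide_rich_path[of ws "{}"] ne ws(2) len by auto
  have "hd ws \<noteq> last ws"
    using ws(2) len k_ge ne by (simp add: hd_conv_nth last_conv_nth nth_eq_iff_index_eq)
  then have "rich (last ws) (hd ws)" using assms(2) ne ws(1) J(1)
    by (metis hd_in_set last_in_set subsetD)
  moreover have "card (set q) < 2 * k" using q(1,5) k_ge by (simp add: distinct_card)
  ultimately obtain m where m: "E (last ws) m" "E m (hd ws)" "m \<notin> set q"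
    using rich_common_neighbour[of "last ws" "hd ws" "set q"] by auto
  have "q \<noteq> []" using q(5) k_ge by auto
  then have "cycle_list E (m # q)" using q m by (simp add: cycle_list_Cons)
  then have "length (m # q) \<noteq> 2 * k" by (rule no_cycle)
  then show False using q(5) k_ge by simp
qed

text \<open>
  Otherwise a path of rich pairs on $k$ vertices of \<open>C\<close>, subdivided and closed through \<open>u\<close>, is a
  $C_{2k}$.
\<close>
lemma rich_pairs_in_neighbourhood:
  assumes "C \<subseteq> nbrs u"
  shows "card (adjacent_pairs rich C) \<le> 2 * k * card C"
proof (rule ccontr)
  assume "\<not> ?thesis"
  then have *: "card (adjacent_pairs rich C) > 2 * k * card C" by simp
  have "finite C" using assms finite_nbrs finite_subset by blast
  from dense_core[OF this rich_sym *]
  obtain W where W: "W \<subseteq> C" "W \<noteq> {}" "\<forall>x\<in>W. k < card {y \<in> W. rich x y}" by blast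
  then obtain x where x: "x \<in> W" by blast
  obtain ws where ws: "distinct ws" "length ws = Suc (k - 1)" "set ws \<subseteq> W" "successively rich ws"
    using path_in_core[of W k rich x "{}" "k - 1"] W(3) x by auto
  have ne: "ws \<noteq> []" using ws(2) by auto
  have adj: "E u w" if "w \<in> set ws" for w using that ws(3) W(1) assms by (metis in_nbrs subsetD)
  then have uw: "set ws \<inter> {u} = {}" using adj_irrefl by blast
  obtain q where q: "distinct q" "successively E q" "hd q = hd ws" "last q = last ws" "length q = 2 * length ws - 1"
      "u \<notin> set q"
    using subdivide_rich_path[of ws "{u}"] ne ws uw k_ge by auto
  have "E u (hd ws)" "E (last ws) u" using adj ne adj_sym by (metis hd_in_set, metis last_in_set)
  moreover have "q \<noteq> []" using q(5) ws(2) k_ge by auto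
  ultimately have "cycle_list E (u # q)" using q by (simp add: cycle_list_Cons)
  then have "length (u # q) \<noteq> 2 * k" by (rule no_cycle)
  then show False using q(5) ws(2) k_ge by simp
qed

end

section \<open>Sums of squared degrees and codegrees\<close>

context cycle_free_graph
begin

text \<open>
  A largest set of pairwise rich neighbours of $v$ in \<open>A\<close> has at most $k-1$ elements, and each
  remaining neighbour of $v$ in \<open>A\<close> forms a thin pair with one of them. Each of the at most
  $|A|^2$ thin pairs is charged in this way for at most $2k$ vertices $v$.
\<close>
lemma sum_deg_subset:
  assumes A: "A \<subseteq> V"
  shows "(\<Sum>a\<in>A. deg a) \<le> (k - 1) * card V + 2 * k * (card A)\<^sup>2"
proof -
  have finA: "finite A" using A finite_verts by (rule finite_subset)
  define T where "T = {p \<in> A \<times> A. thin (fst p) (snd p)}"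
  have finT: "finite T" using finA by (auto simp: T_def)
  have star: "card {a \<in> A. E a v} \<le> (k - 1) + card {p \<in> T. E (fst p) v \<and> E (snd p) v}" for v
  proof -
    let ?S = "{a \<in> A. E a v}" and ?P = "{p \<in> T. E (fst p) v \<and> E (snd p) v}"
    define cliques where "cliques = {I. I \<subseteq> ?S \<and> (\<forall>u\<in>I. \<forall>w\<in>I. u \<noteq> w \<longrightarrow> rich u w)}"
    have "finite cliques" by (rule finite_subset[of _ "Pow ?S"]) (use finA in \<open>auto simp: cliques_def\<close>)
    moreover have "{} \<in> cliques" by (simp add: cliques_def)
    ultimately have "\<exists>I\<in>cliques. {} \<subseteq> I \<and> (\<forall>J\<in>cliques. I \<subseteq> J \<longrightarrow> I = J)" by (rule finite_has_maximal2)
    then obtain I where Icl: "I \<in> cliques" and max: "\<forall>J\<in>cliques. I \<subseteq> J \<longrightarrow> I = J" by blast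
    then have I: "I \<subseteq> ?S" "\<And>u w. u \<in> I \<Longrightarrow> w \<in> I \<Longrightarrow> u \<noteq> w \<Longrightarrow> rich u w"
      unfolding cliques_def by blast+
    have finI: "finite I" using I(1) finA by (auto intro: finite_subset)
    have "card I < k" by (rule no_rich_clique[OF finI I(2)])
    then have cI: "card I \<le> k - 1" by simp
    have "\<exists>b\<in>I. thin u b" if u: "u \<in> ?S - I" for u
    proof (rule ccontr)
      assume no: "\<not> ?thesis"
      have ub: "rich u b" if "b \<in> I" for b
        using no that u by (auto simp: thin_def rich_def)
      have "insert u I \<in> cliques"
        unfolding cliques_def mem_Collect_eq
      proof (intro conjI ballI impI)
        show "insert u I \<subseteq> ?S" using I(1) u by blast
        fix a b assume "a \<in> insert u I" "b \<in> insert u I" "a \<noteq> b"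
        then show "rich a b" using I(2) ub rich_sym by blast
      qed
      then have "I = insert u I" using max by blast
      then show False using u by auto
    qed
    then obtain f where f: "\<And>u. u \<in> ?S - I \<Longrightarrow> f u \<in> I \<and> thin u (f u)" by metis
    have "card (?S - I) \<le> card ?P"
    proof (rule card_inj_on_le[of "\<lambda>u. (u, f u)"])
      show "(\<lambda>u. (u, f u)) ` (?S - I) \<subseteq> ?P" using f I(1) by (fastforce simp: T_def)
    qed (use finT in \<open>auto intro: inj_onI\<close>)
    moreover have "card ?S \<le> card I + card (?S - I)"
      using diff_card_le_card_Diff[OF finI, of ?S] by linarith
    ultimately show ?thesis using cI by linarith
  qed
  have thin_le: "card {v \<in> V. E (fst p) v \<and> E (snd p) v} \<le> 2 * k" if "p \<in> T" for p
  proof -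
    have "{v \<in> V. E (fst p) v \<and> E (snd p) v} = nbrs (fst p) \<inter> nbrs (snd p)"
      using nbrs_subset by auto
    then show ?thesis using that by (auto simp: T_def thin_def codeg_def)
  qed
  have "(\<Sum>a\<in>A. deg a) = (\<Sum>a\<in>A. card {v \<in> V. E a v})"
  proof (rule sum.cong)
    fix a
    have "nbrs a = {v \<in> V. E a v}" using nbrs_subset by auto
    then show "deg a = card {v \<in> V. E a v}" by (simp add: deg_def)
  qed simp
  also have "\<dots> = (\<Sum>v\<in>V. card {a \<in> A. E a v})"
    by (rule sum_multicount_gen[OF finA finite_verts]) simp
  also have "\<dots> \<le> (\<Sum>v\<in>V. (k - 1) + card {p \<in> T. E (fst p) v \<and> E (snd p) v})"
    by (rule sum_mono) (rule star)
  also have "\<dots> = (k - 1) * card V + (\<Sum>v\<in>V. card {p \<in> T. E (fst p) v \<and> E (snd p) v})"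
    by (simp add: sum.distrib)
  also have "(\<Sum>v\<in>V. card {p \<in> T. E (fst p) v \<and> E (snd p) v}) = (\<Sum>p\<in>T. card {v \<in> V. E (fst p) v \<and> E (snd p) v})"
    by (rule sum_multicount_gen[OF finite_verts finT]) simp
  also have "\<dots> \<le> (\<Sum>p\<in>T. 2 * k)" by (rule sum_mono) (rule thin_le)
  also have "\<dots> = 2 * k * card T" by simp
  also have "\<dots> \<le> 2 * k * (card A)\<^sup>2"
  proof (rule mult_le_mono2)
    have "card T \<le> card (A \<times> A)" by (rule card_mono) (use finA in \<open>auto simp: T_def\<close>)
    then show "card T \<le> (card A)\<^sup>2" by (simp add: card_cartesian_product power2_eq_square)
  qed
  finally show ?thesis by simp
qed

text \<open>
  If there were more such vertices, the preceding bound would fail for a set of about $2kn/D$ of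
  them: its quadratic term is then too small to matter.
\<close>
lemma few_high_degree:
  assumes D: "18 * k\<^sup>2 * card V \<le> D\<^sup>2"
  shows "D * card {v \<in> V. D \<le> deg v} \<le> 2 * k * card V"
proof (rule ccontr)
  let ?H = "{v \<in> V. D \<le> deg v}" and ?n = "card V"
  assume no: "\<not> ?thesis"
  then have "?H \<noteq> {}" "0 < D" by (cases D; force)+
  then obtain v where v: "v \<in> V" "D \<le> deg v" by blast
  have n: "0 < ?n" using v(1) finite_verts by (auto simp: card_gt_0_iff)
  have Dn: "D \<le> ?n" using v(2) deg_le le_trans by blast
  \<comment> \<open>The least size for which the degree sum $aD$ of \<open>a\<close> such vertices exceeds $2kn$.\<close>
  define a where "a = (2 * k * ?n) div D + 1"
  have "(2 * k * ?n) div D < card ?H"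
    using no \<open>0 < D\<close> by (metis div_less_iff_less_mult mult.commute not_le)
  then have "a \<le> card ?H" by (simp add: a_def)
  then obtain A where A: "A \<subseteq> ?H" "card A = a" by (metis obtain_subset_with_card_n)
  have aD1: "2 * k * ?n < a * D"
    using div_mult_mod_eq[of "2 * k * ?n" D] mod_less_divisor[OF \<open>0 < D\<close>, of "2 * k * ?n"]
    unfolding a_def add_mult_distrib mult_1 by linarith
  have "(2 * k * ?n) div D * D \<le> 2 * k * ?n" by (rule div_times_less_eq_dividend)
  then have aD2: "a * D \<le> 3 * k * ?n"
  proof -
    have "?n \<le> k * ?n" using k_ge by simp
    then show ?thesis
      using \<open>(2 * k * ?n) div D * D \<le> 2 * k * ?n\<close> Dn unfolding a_def add_mult_distrib mult_1 by linarith
  qed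
  have "a * D \<le> (\<Sum>v\<in>A. deg v)"
    using sum_bounded_below[of A D deg] A by auto
  also have "\<dots> \<le> (k - 1) * ?n + 2 * k * a\<^sup>2"
    using sum_deg_subset[of A] A by auto
  finally have "2 * k * ?n < (k - 1) * ?n + 2 * k * a\<^sup>2" using aD1 by linarith
  moreover have "(k - 1) * ?n \<le> k * ?n" by simp
  ultimately have "k * ?n < 2 * k * a\<^sup>2" by linarith
  then have "?n < 2 * a\<^sup>2" using k_ge by (simp add: mult.assoc)
  then have "?n * D\<^sup>2 < 2 * (a * D)\<^sup>2" using \<open>0 < D\<close> by (simp add: power_mult_distrib)
  also have "\<dots> \<le> 2 * (3 * k * ?n)\<^sup>2" using power_mono[OF aD2, of 2] by simp
  also have "\<dots> = ?n * (18 * k\<^sup>2 * ?n)" by (simp add: power2_eq_square)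
  also have "\<dots> \<le> ?n * D\<^sup>2" using D by simp
  finally show False by simp
qed

lemma sum_odd_below: "(\<Sum>t<m. 2 * t + 1) = (m :: nat)\<^sup>2"
  by (induction m) (auto simp: power2_eq_square)

text \<open>
  Write $\mathrm{deg}^2$ as the sum of $2t+1$ over $t < \mathrm{deg}$. The terms with $t < T$ add up to at
  most $T\cdot\mathrm{deg}$; for each $t \ge T$ the number of vertices with degree above $t$ is $O(n/t)$, so
  every such layer contributes at most $4kn$.
\<close>
lemma sum_deg_square_le:
  assumes T: "18 * k\<^sup>2 * card V \<le> T\<^sup>2" and D: "\<And>v. v \<in> V \<Longrightarrow> deg v \<le> D"
  shows "(\<Sum>v\<in>V. (deg v)\<^sup>2) \<le> T * (\<Sum>v\<in>V. deg v) + 4 * k * card V * D"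
proof -
  have split: "(deg v)\<^sup>2 \<le> T * deg v + (\<Sum>t | t \<in> {T..<D} \<and> t < deg v. 2 * t + 1)" if v: "v \<in> V" for v
  proof (cases "deg v \<le> T")
    case True
    then show ?thesis by (simp add: power2_eq_square trans_le_add1)
  next
    case False
    have "{t. t \<in> {T..<D} \<and> t < deg v} = {T..<deg v}" using D[OF v] by auto
    moreover have "(\<Sum>t<deg v. 2 * t + 1) = (\<Sum>t<T. 2 * t + 1) + (\<Sum>t\<in>{T..<deg v}. 2 * t + 1)"
      using False by (subst sum.union_disjoint[symmetric]) (auto intro!: sum.cong)
    moreover have "T\<^sup>2 \<le> T * deg v" using False by (simp add: power2_eq_square)
    ultimately show ?thesis by (simp only: sum_odd_below)
  qed
  have layer: "(2 * t + 1) * card {v \<in> V. t < deg v} \<le> 4 * k * card V" if "t \<in> {T..<D}" for t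
  proof -
    have "T\<^sup>2 \<le> (Suc t)\<^sup>2" using that by (intro power_mono) auto
    then have "Suc t * card {v \<in> V. Suc t \<le> deg v} \<le> 2 * k * card V"
      using T by (intro few_high_degree) linarith
    then have "2 * (Suc t * card {v \<in> V. t < deg v}) \<le> 4 * k * card V"
      by (simp add: Suc_le_eq)
    moreover have "(2 * t + 1) * card {v \<in> V. t < deg v} \<le> 2 * (Suc t * card {v \<in> V. t < deg v})"
      by (simp add: algebra_simps)
    ultimately show ?thesis by linarith
  qed
  have "(\<Sum>v\<in>V. (deg v)\<^sup>2) \<le> (\<Sum>v\<in>V. T * deg v + (\<Sum>t | t \<in> {T..<D} \<and> t < deg v. 2 * t + 1))"
    by (rule sum_mono) (rule split)
  also have "\<dots> = T * (\<Sum>v\<in>V. deg v) + (\<Sum>v\<in>V. \<Sum>t | t \<in> {T..<D} \<and> t < deg v. 2 * t + 1)"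
    by (simp add: sum.distrib sum_distrib_left)
  also have "(\<Sum>v\<in>V. \<Sum>t | t \<in> {T..<D} \<and> t < deg v. 2 * t + 1)
      = (\<Sum>t\<in>{T..<D}. \<Sum>v | v \<in> V \<and> t < deg v. 2 * t + 1)"
    by (rule sum.swap_restrict) (auto simp: finite_verts)
  also have "\<dots> = (\<Sum>t\<in>{T..<D}. (2 * t + 1) * card {v \<in> V. t < deg v})"
    by (simp add: mult.commute)
  also have "\<dots> \<le> (\<Sum>t\<in>{T..<D}. 4 * k * card V)" by (rule sum_mono) (rule layer)
  also have "\<dots> \<le> 4 * k * card V * D" by simp
  finally show ?thesis by simp
qed

text \<open>
  The left side counts closed walks $u\,w\,v\,w'$; those with $u = v$ or $w = w'$ are counted by
  $\sum \mathrm{deg}^2$. Those in which $u, v$ or $w, w'$ form a thin pair are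
  bounded by $2k \sum \mathrm{codeg}$ each, where the two cases are exchanged by a double count. If both pairs are
  rich, then $w, w'$ is a rich pair inside the neighbourhood of $u$.
\<close>
lemma sum_codeg_square_le:
  "(\<Sum>(u, v)\<in>V \<times> V. (codeg u v)\<^sup>2) \<le> 8 * k * (\<Sum>v\<in>V. (deg v)\<^sup>2)"
proof -
  define S where "S = (\<Sum>v\<in>V. (deg v)\<^sup>2)"
  have fin: "finite (V \<times> V)" using finite_verts by simp
  let ?t = "\<lambda>p. card {q \<in> {q \<in> V \<times> V. thin (fst q) (snd q)}.
      E (fst p) (fst q) \<and> E (fst p) (snd q) \<and> E (snd p) (fst q) \<and> E (snd p) (snd q)}"
  have split: "(codeg u v)\<^sup>2 \<le> (if u = v then (codeg u u)\<^sup>2 else 0) + (4 * k + 1) * codeg u v + ?t (u, v)"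
    if uv: "u \<in> V" "v \<in> V" for u v
  proof -
    have "u = v \<or> thin u v \<or> rich u v" by (auto simp: thin_def rich_def)
    then consider "u = v" | "thin u v" | "rich u v" by blast
    then show ?thesis
    proof cases
      case 2
      then have "(codeg u v)\<^sup>2 \<le> 2 * k * codeg u v" by (simp add: thin_def power2_eq_square)
      then show ?thesis by (simp add: algebra_simps)
    next
      case 3
      define C where "C = nbrs u \<inter> nbrs v"
      have C: "finite C" "C \<subseteq> nbrs u" "C \<subseteq> V" using nbrs_subset by (auto simp: C_def)
      let ?T = "{q \<in> {q \<in> V \<times> V. thin (fst q) (snd q)}.
        E u (fst q) \<and> E u (snd q) \<and> E v (fst q) \<and> E v (snd q)}"
      have "C \<times> C \<subseteq> (\<lambda>w. (w, w)) ` C \<union> (adjacent_pairs rich C \<union> ?T)"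
        using C(3) by (auto simp: adjacent_pairs_def C_def thin_def rich_def)
      then have "card (C \<times> C) \<le> card ((\<lambda>w. (w, w)) ` C \<union> (adjacent_pairs rich C \<union> ?T))"
        using C(1) fin by (intro card_mono) (auto simp: adjacent_pairs_finite)
      also have "\<dots> \<le> card ((\<lambda>w. (w, w)) ` C) + (card (adjacent_pairs rich C) + card ?T)"
        by (meson add_left_mono card_Un_le order_trans)
      also have "\<dots> \<le> card C + (2 * k * card C + card ?T)"
        using rich_pairs_in_neighbourhood[OF C(2)] card_image_le[OF C(1), of "\<lambda>w. (w, w)"] by linarith
      finally have "(codeg u v)\<^sup>2 \<le> codeg u v + (2 * k * codeg u v + card ?T)"
        by (simp add: card_cartesian_product power2_eq_square codeg_def C_def)
      then show ?thesis by (simp add: algebra_simps)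
    qed auto
  qed
  have codeg_alt: "codeg a b = card {v \<in> V. E a v \<and> E b v}" for a b
  proof -
    have "nbrs a \<inter> nbrs b = {v \<in> V. E a v \<and> E b v}" using nbrs_subset by auto
    then show ?thesis by (simp add: codeg_def)
  qed
  have thin_sum: "(\<Sum>p\<in>V \<times> V. ?t p) \<le> 2 * k * S"
  proof -
    have "(\<Sum>p\<in>V \<times> V. ?t p) = (\<Sum>q\<in>{q \<in> V \<times> V. thin (fst q) (snd q)}. (codeg (fst q) (snd q))\<^sup>2)"
    proof (rule sum_multicount_gen)
      show "\<forall>q\<in>{q \<in> V \<times> V. thin (fst q) (snd q)}. card {p \<in> V \<times> V. E (fst p) (fst q) \<and> E (fst p) (snd q) \<and>
          E (snd p) (fst q) \<and> E (snd p) (snd q)} = (codeg (fst q) (snd q))\<^sup>2"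
      proof
        fix q
        let ?C = "nbrs (fst q) \<inter> nbrs (snd q)"
        have "{p \<in> V \<times> V. E (fst p) (fst q) \<and> E (fst p) (snd q) \<and> E (snd p) (fst q) \<and> E (snd p) (snd q)}
            = ?C \<times> ?C"
          using adj_sym adj_verts by (auto simp: nbrs_def)
        then show "card {p \<in> V \<times> V. E (fst p) (fst q) \<and> E (fst p) (snd q) \<and>
          E (snd p) (fst q) \<and> E (snd p) (snd q)} = (codeg (fst q) (snd q))\<^sup>2"
          by (simp add: card_cartesian_product power2_eq_square codeg_def)
      qed
    qed (use fin in auto)
    also have "\<dots> \<le> (\<Sum>q\<in>{q \<in> V \<times> V. thin (fst q) (snd q)}. 2 * k * codeg (fst q) (snd q))"
      by (rule sum_mono) (auto simp: thin_def power2_eq_square)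
    also have "\<dots> \<le> (\<Sum>q\<in>V \<times> V. 2 * k * codeg (fst q) (snd q))"
      using fin by (intro sum_mono2) auto
    also have "\<dots> = 2 * k * (\<Sum>(u, v)\<in>V \<times> V. codeg u v)"
      by (simp add: sum_distrib_left case_prod_unfold)
    finally show ?thesis by (simp add: sum_codeg_eq S_def)
  qed
  have diag: "(\<Sum>(u, v)\<in>V \<times> V. if u = v then (codeg u u)\<^sup>2 else 0) = S"
    using finite_verts by (simp add: sum.cartesian_product[symmetric] S_def codeg_def deg_def)
  have "(\<Sum>(u, v)\<in>V \<times> V. (codeg u v)\<^sup>2)
      \<le> (\<Sum>(u, v)\<in>V \<times> V. (if u = v then (codeg u u)\<^sup>2 else 0) + (4 * k + 1) * codeg u v + ?t (u, v))"
    by (rule sum_mono) (use split in auto)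
  also have "\<dots> = (\<Sum>(u, v)\<in>V \<times> V. if u = v then (codeg u u)\<^sup>2 else 0) +
      (4 * k + 1) * (\<Sum>(u, v)\<in>V \<times> V. codeg u v) + (\<Sum>p\<in>V \<times> V. ?t p)"
    by (simp only: case_prod_unfold sum.distrib sum_distrib_left prod.collapse)
  also have "\<dots> \<le> S + (4 * k + 1) * S + 2 * k * S"
    using thin_sum by (simp add: diag sum_codeg_eq S_def)
  also have "\<dots> = (2 + 6 * k) * S" by (simp add: algebra_simps)
  also have "\<dots> \<le> 8 * k * S" using k_ge by (intro mult_le_mono1) simp
  finally show ?thesis by (simp add: S_def)
qed

end

section \<open>Cycles through a sparse subgraph\<close>

text \<open>
  The squared Frobenius norm of a matrix indexed by \<open>V\<close>.
\<close>
definition sq_norm :: "'a set \<Rightarrow> ('a \<Rightarrow> 'a \<Rightarrow> real) \<Rightarrow> real" where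
  "sq_norm V f = (\<Sum>u\<in>V. \<Sum>v\<in>V. (f u v)\<^sup>2)"

lemma sq_norm_nonneg: "0 \<le> sq_norm V f"
  unfolding sq_norm_def by (intro sum_nonneg) simp

lemma sq_norm_mult:
  "sq_norm V (\<lambda>u v. \<Sum>w\<in>V. f u w * g w v) \<le> sq_norm V f * sq_norm V g"
proof -
  have "sq_norm V (\<lambda>u v. \<Sum>w\<in>V. f u w * g w v)
      \<le> (\<Sum>u\<in>V. \<Sum>v\<in>V. (\<Sum>w\<in>V. (f u w)\<^sup>2) * (\<Sum>w\<in>V. (g w v)\<^sup>2))"
    unfolding sq_norm_def by (intro sum_mono Cauchy_Schwarz_ineq_sum)
  also have "\<dots> = sq_norm V f * (\<Sum>v\<in>V. \<Sum>w\<in>V. (g w v)\<^sup>2)"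
    unfolding sq_norm_def by (simp add: sum_product)
  also have "(\<Sum>v\<in>V. \<Sum>w\<in>V. (g w v)\<^sup>2) = sq_norm V g"
    unfolding sq_norm_def by (rule sum.swap)
  finally show ?thesis .
qed

lemma trace_le:
  "(\<Sum>u\<in>V. \<Sum>v\<in>V. f u v * g v u) \<le> sqrt (sq_norm V f) * sqrt (sq_norm V g)"
proof -
  let ?F = "\<lambda>p. f (fst p) (snd p)" and ?G = "\<lambda>p. g (snd p) (fst p)"
  have "(\<Sum>p\<in>V \<times> V. ?F p * ?G p)\<^sup>2 \<le> (\<Sum>p\<in>V \<times> V. (?F p)\<^sup>2) * (\<Sum>p\<in>V \<times> V. (?G p)\<^sup>2)"
    by (rule Cauchy_Schwarz_ineq_sum)
  moreover have "(\<Sum>p\<in>V \<times> V. ?F p * ?G p) = (\<Sum>u\<in>V. \<Sum>v\<in>V. f u v * g v u)"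
    by (simp add: sum.cartesian_product case_prod_unfold)
  moreover have "(\<Sum>p\<in>V \<times> V. (?F p)\<^sup>2) = sq_norm V f"
    by (simp add: sq_norm_def sum.cartesian_product case_prod_unfold)
  moreover have "(\<Sum>p\<in>V \<times> V. (?G p)\<^sup>2) = (\<Sum>u\<in>V. \<Sum>v\<in>V. (g v u)\<^sup>2)"
    by (simp add: sum.cartesian_product case_prod_unfold)
  moreover have "(\<Sum>u\<in>V. \<Sum>v\<in>V. (g v u)\<^sup>2) = sq_norm V g"
    unfolding sq_norm_def by (rule sum.swap)
  ultimately have "(\<Sum>u\<in>V. \<Sum>v\<in>V. f u v * g v u)\<^sup>2 \<le> sq_norm V f * sq_norm V g" by simp
  then show ?thesis
    by (simp add: real_sqrt_mult[symmetric] real_le_rsqrt)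
qed

text \<open>
  Since $\|ea\|^2 = \mathrm{tr}(e^{T} e\, a a^{T})$ for matrices $e$ and $a$, this is an instance of the
  preceding trace inequality.
\<close>
lemma sq_norm_gram:
  "sq_norm V (\<lambda>u v. \<Sum>w\<in>V. e u w * a w v)
    \<le> sqrt (sq_norm V (\<lambda>w w'. \<Sum>u\<in>V. e u w * e u w')) * sqrt (sq_norm V (\<lambda>w w'. \<Sum>v\<in>V. a w v * a w' v))"
proof -
  have "sq_norm V (\<lambda>u v. \<Sum>w\<in>V. e u w * a w v)
      = (\<Sum>u\<in>V. \<Sum>v\<in>V. \<Sum>w\<in>V. \<Sum>w'\<in>V. (e u w * e u w') * (a w v * a w' v))"
    unfolding sq_norm_def by (simp add: power2_eq_square sum_product mult_ac)
  also have "\<dots> = (\<Sum>u\<in>V. \<Sum>w\<in>V. \<Sum>v\<in>V. \<Sum>w'\<in>V. (e u w * e u w') * (a w v * a w' v))"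
    by (rule sum.cong[OF refl]) (rule sum.swap)
  also have "\<dots> = (\<Sum>u\<in>V. \<Sum>w\<in>V. \<Sum>w'\<in>V. \<Sum>v\<in>V. (e u w * e u w') * (a w v * a w' v))"
    by (rule sum.cong[OF refl], rule sum.cong[OF refl]) (rule sum.swap)
  also have "\<dots> = (\<Sum>w\<in>V. \<Sum>u\<in>V. \<Sum>w'\<in>V. \<Sum>v\<in>V. (e u w * e u w') * (a w v * a w' v))"
    by (rule sum.swap)
  also have "\<dots> = (\<Sum>w\<in>V. \<Sum>w'\<in>V. \<Sum>u\<in>V. \<Sum>v\<in>V. (e u w * e u w') * (a w v * a w' v))"
    by (rule sum.cong[OF refl]) (rule sum.swap)
  also have "\<dots> = (\<Sum>w\<in>V. \<Sum>w'\<in>V. (\<Sum>u\<in>V. e u w * e u w') * (\<Sum>v\<in>V. a w v * a w' v))"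
    by (simp only: sum_product)
  also have "\<dots> = (\<Sum>w\<in>V. \<Sum>w'\<in>V. (\<Sum>u\<in>V. e u w * e u w') * (\<Sum>v\<in>V. a w' v * a w v))"
    by (simp add: mult.commute)
  also have "\<dots> \<le> sqrt (sq_norm V (\<lambda>w w'. \<Sum>u\<in>V. e u w * e u w')) * sqrt (sq_norm V (\<lambda>w w'. \<Sum>v\<in>V. a w v * a w' v))"
    by (rule trace_le)
  finally show ?thesis .
qed

context fin_graph
begin

lemma codeg_eq_sum: "real (codeg u v) = (\<Sum>w\<in>V. of_bool (E u w) * of_bool (E v w))"
proof -
  have "nbrs u \<inter> nbrs v = V \<inter> {w. E u w \<and> E v w}" using nbrs_subset by auto
  then show ?thesis
    using finite_verts by (simp add: codeg_def of_bool_conj[symmetric])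
qed

text \<open>
  Only the interior vertices of a walk are recorded, so that \<open>inner_walks 1\<close> is counted by the codegree
  and longer walks of even length by powers of the codegree matrix.
\<close>
definition inner_walks :: "nat \<Rightarrow> 'a \<Rightarrow> 'a \<Rightarrow> 'a list set" where
  "inner_walks j u v = {q. length q = j \<and> successively E (u # q @ [v])}"

lemma finite_inner_walks: "finite (inner_walks j u v)"
proof (rule finite_subset)
  show "inner_walks j u v \<subseteq> {q. set q \<subseteq> V \<and> length q = j}"
  proof
    fix q assume q: "q \<in> inner_walks j u v"
    have "set q \<subseteq> V" if "successively E (a # q @ [v])" for a q
      using that
    proof (induction q arbitrary: a)
      case (Cons b q)
      then have "E a b" "set q \<subseteq> V" by auto
      then show ?case using adj_verts' by auto
    qed simp
    then show "q \<in> {q. set q \<subseteq> V \<and> length q = j}" using q by (auto simp: inner_walks_def)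
  qed
qed (use finite_lists_length_eq[OF finite_verts] in auto)

lemma card_inner_walks_1: "card (inner_walks 1 u v) = codeg u v"
proof -
  have "inner_walks 1 u v = (\<lambda>w. [w]) ` (nbrs u \<inter> nbrs v)"
  proof
    show "inner_walks 1 u v \<subseteq> (\<lambda>w. [w]) ` (nbrs u \<inter> nbrs v)"
      using adj_sym by (auto simp: inner_walks_def length_Suc_conv)
    show "(\<lambda>w. [w]) ` (nbrs u \<inter> nbrs v) \<subseteq> inner_walks 1 u v"
      using adj_sym by (auto simp: inner_walks_def)
  qed
  then show ?thesis by (simp add: card_image inj_on_def codeg_def)
qed

lemma card_inner_walks_step:
  "card (inner_walks (j + 2) u v) \<le> (\<Sum>w\<in>V. codeg u w * card (inner_walks j w v))"
proof -
  have "inner_walks (j + 2) u v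
      \<subseteq> (\<Union>w\<in>V. (\<lambda>(a, q). a # w # q) ` ((nbrs u \<inter> nbrs w) \<times> inner_walks j w v))"
  proof
    fix q assume q: "q \<in> inner_walks (j + 2) u v"
    then obtain a w q' where eq: "q = a # w # q'" by (auto simp: inner_walks_def length_Suc_conv numeral_2_eq_2)
    have *: "E u a" "E a w" "q' \<in> inner_walks j w v" using q by (auto simp: eq inner_walks_def)
    then have "E w a" "w \<in> V" using adj_sym adj_verts' by blast+
    then show "q \<in> (\<Union>w\<in>V. (\<lambda>(a, q). a # w # q) ` ((nbrs u \<inter> nbrs w) \<times> inner_walks j w v))"
      using * by (force simp: eq)
  qed
  then have "card (inner_walks (j + 2) u v)
      \<le> card (\<Union>w\<in>V. (\<lambda>(a, q). a # w # q) ` ((nbrs u \<inter> nbrs w) \<times> inner_walks j w v))"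
    by (intro card_mono) (auto simp: finite_verts finite_inner_walks)
  also have "\<dots> \<le> (\<Sum>w\<in>V. card ((\<lambda>(a, q). a # w # q) ` ((nbrs u \<inter> nbrs w) \<times> inner_walks j w v)))"
    by (rule card_UN_le[OF finite_verts])
  also have "\<dots> \<le> (\<Sum>w\<in>V. codeg u w * card (inner_walks j w v))"
  proof (rule sum_mono)
    fix w
    have "card ((\<lambda>(a, q). a # w # q) ` ((nbrs u \<inter> nbrs w) \<times> inner_walks j w v))
        \<le> card ((nbrs u \<inter> nbrs w) \<times> inner_walks j w v)"
      by (rule card_image_le) (simp add: finite_inner_walks)
    then show "card ((\<lambda>(a, q). a # w # q) ` ((nbrs u \<inter> nbrs w) \<times> inner_walks j w v))
        \<le> codeg u w * card (inner_walks j w v)"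
      by (simp add: card_cartesian_product codeg_def)
  qed
  finally show ?thesis .
qed

lemma sq_norm_inner_walks:
  "sq_norm V (\<lambda>u v. real (card (inner_walks (2 * j + 1) u v))) \<le> sq_norm V (\<lambda>u v. real (codeg u v)) ^ Suc j"
proof (induction j)
  case 0
  show ?case by (simp only: mult_0_right add_0 card_inner_walks_1 power_one_right) simp
next
  case (Suc j)
  let ?w = "\<lambda>j u v. real (card (inner_walks (2 * j + 1) u v))"
  have "sq_norm V (?w (Suc j)) \<le> sq_norm V (\<lambda>u v. \<Sum>w\<in>V. real (codeg u w) * ?w j w v)"
    unfolding sq_norm_def
  proof (intro sum_mono power_mono)
    fix u v
    have "card (inner_walks (2 * j + 1 + 2) u v) \<le> (\<Sum>w\<in>V. codeg u w * card (inner_walks (2 * j + 1) w v))"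
      by (rule card_inner_walks_step)
    then have "real (card (inner_walks (2 * j + 1 + 2) u v))
        \<le> real (\<Sum>w\<in>V. codeg u w * card (inner_walks (2 * j + 1) w v))"
      by (rule of_nat_mono)
    then show "?w (Suc j) u v \<le> (\<Sum>w\<in>V. real (codeg u w) * ?w j w v)" by simp
  qed simp
  also have "\<dots> \<le> sq_norm V (\<lambda>u v. real (codeg u v)) * sq_norm V (?w j)"
    by (rule sq_norm_mult)
  also have "\<dots> \<le> sq_norm V (\<lambda>u v. real (codeg u v)) * sq_norm V (\<lambda>u v. real (codeg u v)) ^ Suc j"
    by (rule mult_left_mono[OF Suc.IH sq_norm_nonneg])
  finally show ?case by simp
qed

definition cycles :: "nat \<Rightarrow> 'a list set" where
  "cycles m = {p. cycle_list E p \<and> length p = m}"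

lemma cycle_verts: 
  assumes "cycle_list E p" shows "set p \<subseteq> V"
proof -
  have "set q \<subseteq> V" if "successively E (q @ [a])" for q a
    using that
  proof (induction q)
    case (Cons b q)
    then have "E b (hd (q @ [a]))" "set q \<subseteq> V" by (auto simp: successively_Cons)
    then show ?case using adj_verts by auto
  qed simp
  then show ?thesis using assms by (auto simp: cycle_list_def)
qed

lemma cycles_subset: "cycles m \<subseteq> {p. set p \<subseteq> V \<and> length p = m}"
  using cycle_verts by (auto simp: cycles_def)

lemma finite_cycles: "finite (cycles m)"
  by (rule finite_subset[OF cycles_subset finite_lists_length_eq[OF finite_verts]])

lemma card_cycles_le: "card (cycles m) \<le> card V ^ m"
  using card_mono[OF finite_lists_length_eq[OF finite_verts] cycles_subset]
  by (simp add: card_lists_length_eq finite_verts)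

end

locale fin_graph_with_subgraph = fin_graph V E + S: fin_graph V E'
  for V :: "'a set" and E E' :: "'a \<Rightarrow> 'a \<Rightarrow> bool" +
  assumes sub: "E' x y \<Longrightarrow> E x y"
begin

text \<open>
  The first two edges of the cycle contribute the product of the adjacency matrices of \<open>E'\<close> and \<open>E\<close>,
  and the remaining $2\ell-2$ edges contribute the $(\ell-1)$st power of the codegree matrix.
\<close>
lemma cycles_starting_in_subgraph:
  assumes l: "l \<ge> 2"
    and C: "(\<Sum>u\<in>V. \<Sum>v\<in>V. (real (codeg u v))\<^sup>2) \<le> C\<^sup>2" "0 \<le> C"
    and D: "(\<Sum>u\<in>V. \<Sum>v\<in>V. (real (S.codeg u v))\<^sup>2) \<le> D\<^sup>2" "0 \<le> D"
  shows "real (card {p \<in> cycles (2 * l). E' (p ! 0) (p ! 1)}) \<le> sqrt (D * C) * C ^ (l - 1)"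
proof -
  obtain j where j: "l = j + 2" using l by (metis add.commute le_Suc_ex)
  define P where "P u v = {w. E' u w \<and> E w v}" for u v
  define W where "W u v = inner_walks (2 * j + 1) u v" for u v
  have PV: "P u v \<subseteq> V" for u v using S.adj_verts' by (auto simp: P_def)
  have finP: "finite (P u v)" for u v using finite_subset[OF PV finite_verts] .
  have "{p \<in> cycles (2 * l). E' (p ! 0) (p ! 1)}
      \<subseteq> (\<Union>(u, v)\<in>V \<times> V. (\<lambda>(w, q). u # w # v # q) ` (P u v \<times> W v u))"
  proof
    fix p assume "p \<in> {p \<in> cycles (2 * l). E' (p ! 0) (p ! 1)}"
    then have p: "cycle_list E p" "length p = 2 * l" "E' (p ! 0) (p ! 1)" by (auto simp: cycles_def)
    have "length p = Suc (Suc (Suc (2 * j + 1)))" using p(2) j by simp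
    then obtain u w v q where eq: "p = u # w # v # q" "length q = 2 * j + 1"
      by (auto simp: length_Suc_conv)
    have "E' u w" using p(3) eq by simp
    moreover have "E w v" "q \<in> W v u" using p(1) eq by (auto simp: cycle_list_def W_def inner_walks_def)
    ultimately have "w \<in> P u v" "u \<in> V" "v \<in> V" using adj_verts' S.adj_verts by (auto simp: P_def)
    then show "p \<in> (\<Union>(u, v)\<in>V \<times> V. (\<lambda>(w, q). u # w # v # q) ` (P u v \<times> W v u))"
      using \<open>q \<in> W v u\<close> by (force simp: eq)
  qed
  then have "card {p \<in> cycles (2 * l). E' (p ! 0) (p ! 1)}
      \<le> card (\<Union>(u, v)\<in>V \<times> V. (\<lambda>(w, q). u # w # v # q) ` (P u v \<times> W v u))"
    by (intro card_mono) (auto simp: finite_verts finP W_def finite_inner_walks)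
  also have "\<dots> \<le> (\<Sum>(u, v)\<in>V \<times> V. card ((\<lambda>(w, q). u # w # v # q) ` (P u v \<times> W v u)))"
    unfolding case_prod_unfold by (rule card_UN_le) (simp add: finite_verts)
  also have "\<dots> \<le> (\<Sum>(u, v)\<in>V \<times> V. card (P u v) * card (W v u))"
  proof (rule sum_mono, clarify)
    fix u v
    have "card ((\<lambda>(w, q). u # w # v # q) ` (P u v \<times> W v u)) \<le> card (P u v \<times> W v u)"
      by (rule card_image_le) (simp add: W_def finP finite_inner_walks)
    then show "card ((\<lambda>(w, q). u # w # v # q) ` (P u v \<times> W v u)) \<le> card (P u v) * card (W v u)"
      by (simp only: card_cartesian_product)
  qed
  finally have "real (card {p \<in> cycles (2 * l). E' (p ! 0) (p ! 1)})
      \<le> real (\<Sum>(u, v)\<in>V \<times> V. card (P u v) * card (W v u))" by (rule of_nat_mono)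
  also have "\<dots> = (\<Sum>u\<in>V. \<Sum>v\<in>V. real (card (P u v)) * real (card (W v u)))"
    by (simp add: sum.cartesian_product case_prod_unfold)
  also have "\<dots> \<le> sqrt (sq_norm V (\<lambda>u v. real (card (P u v)))) * sqrt (sq_norm V (\<lambda>u v. real (card (W u v))))"
    by (rule trace_le)
  also have "\<dots> \<le> sqrt (D * C) * C ^ (l - 1)"
  proof (rule mult_mono)
    have codeg2: "sq_norm V (\<lambda>u v. real (codeg u v)) \<le> C\<^sup>2" "sq_norm V (\<lambda>u v. real (S.codeg u v)) \<le> D\<^sup>2"
      using C D by (simp_all add: sq_norm_def)
    have "real (card (P u v)) = (\<Sum>w\<in>V. of_bool (E' u w) * of_bool (E w v))" for u v
    proof -
      have "P u v = V \<inter> {w. E' u w \<and> E w v}" using PV by (auto simp: P_def)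
      then show ?thesis using finite_verts by (simp add: of_bool_conj[symmetric])
    qed
    then have "sq_norm V (\<lambda>u v. real (card (P u v)))
        \<le> sqrt (sq_norm V (\<lambda>w w'. \<Sum>u\<in>V. of_bool (E' u w) * of_bool (E' u w'))) *
          sqrt (sq_norm V (\<lambda>w w'. \<Sum>v\<in>V. of_bool (E w v) * of_bool (E w' v)))"
      by (simp only: sq_norm_gram)
    also have "(\<lambda>w w'. \<Sum>u\<in>V. of_bool (E' u w) * of_bool (E' u w')) = (\<lambda>w w'. real (S.codeg w w'))"
    proof (intro ext)
      fix w w'
      have "E' u w = E' w u" for u w using S.adj_sym by blast
      then show "(\<Sum>u\<in>V. of_bool (E' u w) * of_bool (E' u w')) = real (S.codeg w w')"
        by (simp only: S.codeg_eq_sum)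
    qed
    also have "(\<lambda>w w'. \<Sum>v\<in>V. of_bool (E w v) * of_bool (E w' v)) = (\<lambda>w w'. real (codeg w w'))"
      by (simp only: codeg_eq_sum)
    also have "sqrt (sq_norm V (\<lambda>w w'. real (S.codeg w w'))) * sqrt (sq_norm V (\<lambda>w w'. real (codeg w w'))) \<le> D * C"
      using codeg2 C(2) D(2) by (intro mult_mono) (auto simp: real_le_lsqrt sq_norm_nonneg)
    finally show "sqrt (sq_norm V (\<lambda>u v. real (card (P u v)))) \<le> sqrt (D * C)" by simp
    have "sq_norm V (\<lambda>u v. real (card (W u v))) \<le> sq_norm V (\<lambda>u v. real (codeg u v)) ^ Suc j"
      unfolding W_def by (rule sq_norm_inner_walks)
    also have "\<dots> \<le> (C\<^sup>2) ^ Suc j" by (rule power_mono[OF codeg2(1) sq_norm_nonneg])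
    also have "\<dots> = (C ^ (l - 1))\<^sup>2" by (simp only: j power_mult[symmetric]) (simp add: mult.commute)
    finally show "sqrt (sq_norm V (\<lambda>u v. real (card (W u v)))) \<le> C ^ (l - 1)"
      using C(2) by (simp add: real_le_lsqrt sq_norm_nonneg)
  qed (use C(2) D(2) in \<open>auto simp: sq_norm_nonneg\<close>)
  finally show ?thesis .
qed

text \<open>
  Rotating the cycle moves the edge of \<open>E'\<close> to the front.
\<close>
lemma cycles_meeting_subgraph:
  assumes l: "l \<ge> 2"
    and C: "(\<Sum>u\<in>V. \<Sum>v\<in>V. (real (codeg u v))\<^sup>2) \<le> C\<^sup>2" "0 \<le> C"
    and D: "(\<Sum>u\<in>V. \<Sum>v\<in>V. (real (S.codeg u v))\<^sup>2) \<le> D\<^sup>2" "0 \<le> D"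
  shows "real (card {p \<in> cycles (2 * l). \<exists>i<2 * l. E' (p ! i) (p ! (Suc i mod (2 * l)))})
      \<le> 2 * real l * (sqrt (D * C) * C ^ (l - 1))"
proof -
  define S0 where "S0 = {p \<in> cycles (2 * l). E' (p ! 0) (p ! 1)}"
  have fin: "finite S0" using finite_cycles by (auto simp: S0_def)
  have "{p \<in> cycles (2 * l). \<exists>i<2 * l. E' (p ! i) (p ! (Suc i mod (2 * l)))}
      \<subseteq> (\<Union>i<2 * l. rotate (2 * l - i) ` S0)"
  proof
    fix p assume "p \<in> {p \<in> cycles (2 * l). \<exists>i<2 * l. E' (p ! i) (p ! (Suc i mod (2 * l)))}"
    then obtain i where p: "cycle_list E p" "length p = 2 * l" and i: "i < 2 * l" "E' (p ! i) (p ! (Suc i mod (2 * l)))"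
      by (auto simp: cycles_def)
    have "E' (rotate i p ! 0) (rotate i p ! 1)"
      using i p(2) l by (simp add: nth_rotate)
    then have "rotate i p \<in> S0"
      using p by (simp add: S0_def cycles_def cycle_list_rotate)
    moreover have "rotate (2 * l - i) (rotate i p) = p"
      using i(1) p(2) by (simp add: rotate_rotate)
    ultimately show "p \<in> (\<Union>i<2 * l. rotate (2 * l - i) ` S0)" using i(1) by force
  qed
  then have "card {p \<in> cycles (2 * l). \<exists>i<2 * l. E' (p ! i) (p ! (Suc i mod (2 * l)))}
      \<le> card (\<Union>i<2 * l. rotate (2 * l - i) ` S0)"
    by (intro card_mono) (auto simp: fin)
  also have "\<dots> \<le> (\<Sum>i<2 * l. card (rotate (2 * l - i) ` S0))"
    by (rule card_UN_le) simp
  also have "\<dots> \<le> (\<Sum>i<2 * l. card S0)"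
    by (rule sum_mono) (rule card_image_le[OF fin])
  finally have "real (card {p \<in> cycles (2 * l). \<exists>i<2 * l. E' (p ! i) (p ! (Suc i mod (2 * l)))})
      \<le> real (2 * l * card S0)" by (intro of_nat_mono) simp
  also have "\<dots> = 2 * real l * real (card S0)" by simp
  also have "\<dots> \<le> 2 * real l * (sqrt (D * C) * C ^ (l - 1))"
    using cycles_starting_in_subgraph[OF assms] by (intro mult_left_mono) (auto simp: S0_def)
  finally show ?thesis .
qed

end

section \<open>Cycles alternating between two classes\<close>

lemma set_splice: "set (splice xs ys) = set xs \<union> set ys"
  by (induction xs ys rule: splice.induct) auto

lemma distinct_splice:
  "distinct (splice xs ys) \<longleftrightarrow> distinct xs \<and> distinct ys \<and> set xs \<inter> set ys = {}"
  by (induction xs ys rule: splice.induct) (auto simp: set_splice)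

text \<open>
  Splitting an alternating walk into its vertices inside and outside \<open>H\<close>.
\<close>
lemma splice_alternating:
  assumes split: "\<And>x y. E x y \<Longrightarrow> x \<in> H \<longleftrightarrow> y \<notin> H"
    and "successively E p" "even (length p)" "p \<noteq> [] \<Longrightarrow> hd p \<in> H"
  shows "\<exists>xs ys. p = splice xs ys \<and> length p = 2 * length xs \<and> length ys = length xs \<and>
    set xs \<subseteq> H \<and> set ys \<inter> H = {} \<and> (\<forall>x\<in>set xs. \<exists>y\<in>set ys. E x y)"
  using assms(2-)
proof (induction p rule: induct_list012)
  case 1
  show ?case by (intro exI[of _ "[]"]) simp
next
  case (3 x y q)
  have xy: "E x y" "x \<in> H" "y \<notin> H" using 3 split[of x y] by auto
  have "hd q \<in> H" if "q \<noteq> []"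
    using that 3 xy split[of y "hd q"] by (auto simp: successively_Cons)
  moreover have "successively E q" "even (length q)" using 3 by (auto simp: successively_Cons)
  ultimately obtain xs ys where "q = splice xs ys" "length q = 2 * length xs" "length ys = length xs"
      "set xs \<subseteq> H" "set ys \<inter> H = {}" "\<forall>x\<in>set xs. \<exists>y\<in>set ys. E x y"
    using "3.IH"(1) by blast
  with xy show ?case by (intro exI[of _ "x # xs"] exI[of _ "y # ys"]) auto
qed simp

lemma card_distinct_lists_mono:
  assumes "finite U" "card U \<le> m"
  shows "card {xs. length xs = l \<and> distinct xs \<and> set xs \<subseteq> U}
    \<le> card {xs. length xs = l \<and> distinct xs \<and> set xs \<subseteq> {..<m}}"
proof -
  obtain h where h: "inj_on h U" "h ` U \<subseteq> {..<m}"
    using card_le_inj[OF assms(1), of "{..<m}"] assms(2) by auto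
  show ?thesis
  proof (rule card_inj_on_le[of "map h"])
    show "inj_on (map h) {xs. length xs = l \<and> distinct xs \<and> set xs \<subseteq> U}"
      by (rule inj_on_subset[OF inj_on_map_lists[OF h(1)]]) auto
    show "map h ` {xs. length xs = l \<and> distinct xs \<and> set xs \<subseteq> U}
        \<subseteq> {xs. length xs = l \<and> distinct xs \<and> set xs \<subseteq> {..<m}}"
      using h by (fastforce simp: distinct_map image_subset_iff intro: inj_on_subset)
    show "finite {xs. length xs = l \<and> distinct xs \<and> set xs \<subseteq> {..<m}}"
      by (rule finite_subset[OF _ finite_lists_length_eq[of "{..<m}" l]]) auto
  qed
qed

text \<open>
  A $C_{2k}$-free graph with all edges between \<open>H\<close> and its complement. In the application \<open>H\<close> consists
  of the boundedly many heavy vertices.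
\<close>
locale split_graph = cycle_free_graph +
  fixes H :: "'a set"
  assumes H_subset: "H \<subseteq> V"
    and split: "E x y \<Longrightarrow> x \<in> H \<longleftrightarrow> y \<notin> H"
begin

text \<open>
  There are enough vertices of the same type as \<open>y\<close> to supply fresh ones until a cycle has length
  $2k$.
\<close>
definition frequent :: "'a \<Rightarrow> bool" where
  "frequent y \<longleftrightarrow> k \<le> card {y' \<in> V - H. nbrs y' = nbrs y}"

definition support :: "'a list \<Rightarrow> 'a set" where
  "support p = \<Union> (nbrs ` (set p - H))"

lemma finite_H: "finite H"
  using H_subset finite_verts by (rule finite_subset)

lemma support_subset: "support p \<subseteq> H"
  using split by (auto simp: support_def)

text \<open>
  Behind \<open>y\<close> insert \<open>u\<close> and \<open>y'\<close>; the successor of \<open>y\<close> on the cycle is also adjacent to \<open>y'\<close>.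
\<close>
lemma grow_cycle:
  assumes p: "cycle_list E p" "y \<in> set p" and u: "E y u" "u \<notin> set p"
    and y': "nbrs y' = nbrs y" "y' \<notin> set p"
  shows "\<exists>q. cycle_list E q \<and> length q = length p + 2 \<and> set q = insert u (insert y' (set p))"
proof -
  obtain i where i: "i < length p" "p ! i = y" using p(2) by (auto simp: in_set_conv_nth)
  define p0 where "p0 = rotate (Suc i) p"
  have ne: "p0 \<noteq> []" using p(2) by (auto simp: p0_def)
  have c0: "cycle_list E p0" unfolding p0_def by (rule cycle_list_rotate[OF p(1)])
  have len: "length p0 = length p" "set p0 = set p" by (simp_all add: p0_def)
  have "last p0 = p0 ! (length p - 1)" by (simp add: last_conv_nth[OF ne] len(1))
  also have "\<dots> = p ! ((Suc i + (length p - 1)) mod length p)"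
    unfolding p0_def by (rule nth_rotate) (use i(1) in simp)
  also have "Suc i + (length p - 1) = i + length p" using i(1) by simp
  finally have last: "last p0 = y" using i by simp
  have "E y (hd p0)" "successively E p0" "distinct p0"
    using c0 ne last by (auto simp: cycle_list_def successively_append_iff)
  moreover have "E y' b" if "E y b" for b using y'(1) that by (metis in_nbrs)
  ultimately have adj: "E y' (hd p0)" "E y' u" using u(1) by auto
  then have "E u y'" "u \<noteq> y'" using adj_sym adj_irrefl by auto
  then have "cycle_list E (p0 @ [u, y'])"
    using \<open>successively E p0\<close> \<open>distinct p0\<close> ne last adj u y'(2) len
    by (auto simp: cycle_list_def successively_append_iff)
  then show ?thesis using len by (intro exI[of _ "p0 @ [u, y']"]) auto
qed

text \<open>
  If the support has at least $k$ elements, a cycle of length below $2k$ misses one of them and can be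
  lengthened by \<open>grow_cycle\<close>. The new vertex has the type of an old one, so the support and
  frequency are preserved, and length $2k$ is eventually reached.
\<close>
lemma support_small:
  assumes p: "cycle_list E p" "length p = 2 * j" "card (set p \<inter> H) = j" "card (set p - H) = j"
    and freq: "\<And>y. y \<in> set p - H \<Longrightarrow> frequent y" and "j \<le> k"
  shows "card (support p) < k"
proof (rule ccontr)
  assume large: "\<not> ?thesis"
  have "\<exists>q. cycle_list E q \<and> length q = 2 * (j + i) \<and> card (set q \<inter> H) = j + i \<and> card (set q - H) = j + i \<and>
      (\<forall>y\<in>set q - H. frequent y) \<and> support p \<subseteq> support q" if "j + i \<le> k" for i
    using that
  proof (induction i)
    case 0
    then show ?case using p freq by (intro exI[of _ p]) auto
  next
    case (Suc i)
    then obtain q where q: "cycle_list E q" "length q = 2 * (j + i)" "card (set q \<inter> H) = j + i" "card (set q - H) = j + i"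
        "\<forall>y\<in>set q - H. frequent y" "support p \<subseteq> support q" by auto
    have "card (set q \<inter> H) < card (support p)" using q(3) Suc.prems large by linarith
    then have "\<not> support p \<subseteq> set q \<inter> H" by (metis List.finite_set card_mono finite_Int not_le)
    then obtain u where u: "u \<in> support p" "u \<notin> set q" using support_subset by blast
    then have "u \<in> H" using support_subset by blast
    have "u \<in> support q" using u(1) q(6) by blast
    then obtain y where y: "y \<in> set q" "y \<notin> H" "E y u" by (auto simp: support_def)
    have "card (set q - H) < card {y' \<in> V - H. nbrs y' = nbrs y}"
      using q(4,5) y Suc.prems by (force simp: frequent_def)
    then have "\<not> {y' \<in> V - H. nbrs y' = nbrs y} \<subseteq> set q - H" by (metis List.finite_set card_mono finite_Diff not_le)
    then obtain y' where y': "y' \<notin> H" "nbrs y' = nbrs y" "y' \<notin> set q" by auto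
    obtain q' where q': "cycle_list E q'" "length q' = length q + 2" "set q' = insert u (insert y' (set q))"
      using grow_cycle[OF q(1) y(1,3) u(2) y'(2,3)] by blast
    have sets: "set q' \<inter> H = insert u (set q \<inter> H)" "set q' - H = insert y' (set q - H)"
      using q'(3) y'(1) \<open>u \<in> H\<close> by auto
    have "frequent y'" using q(5) y y'(2) by (simp add: frequent_def)
    have "card (set q' \<inter> H) = j + Suc i" "card (set q' - H) = j + Suc i"
      unfolding sets using u(2) y'(3) q(3,4) by simp_all
    moreover have "\<forall>y\<in>set q' - H. frequent y" unfolding sets using q(5) \<open>frequent y'\<close> by blast
    moreover have "support p \<subseteq> support q'" using q(6) unfolding support_def sets by auto
    ultimately show ?case using q' q(2) by (intro exI[of _ q']) auto
  qed
  from this[of "k - j"] obtain q where "cycle_list E q" "length q = 2 * k"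
    using \<open>j \<le> k\<close> by auto
  then show False using no_cycle by blast
qed

lemma split_cycle:
  assumes "p \<in> cycles (2 * l)" "hd p \<in> H"
  obtains xs ys where "p = splice xs ys" "length xs = l" "length ys = l" "distinct xs"
    "set xs \<subseteq> H" "set ys \<subseteq> V" "set p - H = set ys" "set p \<inter> H = set xs" "card (set ys) = l"
    "set xs \<subseteq> support p"
proof -
  have p: "cycle_list E p" "length p = 2 * l" using assms(1) by (auto simp: cycles_def)
  then have "successively E p" "distinct p" by (auto simp: cycle_list_def successively_append_iff)
  then obtain xs ys where xy: "p = splice xs ys" "length p = 2 * length xs" "length ys = length xs"
    "set xs \<subseteq> H" "set ys \<inter> H = {}" "\<forall>x\<in>set xs. \<exists>y\<in>set ys. E x y"
    using splice_alternating[of E H p, OF split] assms(2) p(2) by auto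
  have sp: "set p = set xs \<union> set ys" by (simp add: xy(1) set_splice)
  have "distinct xs" "distinct ys" using \<open>distinct p\<close> by (simp_all add: xy(1) distinct_splice)
  then have "card (set ys) = l" using xy(2,3) p(2) by (simp add: distinct_card)
  have "set p \<subseteq> V" using cycle_verts p(1) by blast
  moreover have sets: "set p - H = set ys" "set p \<inter> H = set xs" using sp xy(4,5) by auto
  moreover have "\<forall>x\<in>set xs. \<exists>y\<in>set ys. E y x" using xy(6) adj_sym by blast
  then have "set xs \<subseteq> support p"
    unfolding support_def sets by auto
  ultimately show ?thesis
    using that[of xs ys] xy p(2) \<open>distinct xs\<close> \<open>card (set ys) = l\<close> sp by auto
qed

text \<open>
  There are at most $2^{|H|}$ types, and a rare type has fewer than $k$ vertices.
\<close>
lemma card_rare: "card {y \<in> V - H. \<not> frequent y} \<le> 2 ^ card H * k"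
proof -
  let ?R = "{y \<in> V - H. \<not> frequent y}"
  have "?R \<subseteq> (\<Union>T\<in>Pow H. {y \<in> ?R. nbrs y = T})"
  proof
    fix y assume "y \<in> ?R"
    then have "nbrs y \<in> Pow H" using split by (auto simp: nbrs_def)
    with \<open>y \<in> ?R\<close> show "y \<in> (\<Union>T\<in>Pow H. {y \<in> ?R. nbrs y = T})" by auto
  qed
  then have "card ?R \<le> card (\<Union>T\<in>Pow H. {y \<in> ?R. nbrs y = T})"
    by (intro card_mono) (auto simp: finite_H finite_verts)
  also have "\<dots> \<le> (\<Sum>T\<in>Pow H. card {y \<in> ?R. nbrs y = T})"
    by (rule card_UN_le) (simp add: finite_H)
  also have "\<dots> \<le> (\<Sum>T\<in>Pow H. k)"
  proof (rule sum_mono)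
    fix T
    show "card {y \<in> ?R. nbrs y = T} \<le> k"
    proof (cases "{y \<in> ?R. nbrs y = T} = {}")
      case True
      then show ?thesis by (simp only: card.empty)
    next
      case False
      then obtain y where y: "\<not> frequent y" "nbrs y = T" by auto
      have "card {y \<in> ?R. nbrs y = T} \<le> card {y' \<in> V - H. nbrs y' = nbrs y}"
        using y by (intro card_mono) (auto simp: finite_verts)
      then show ?thesis using y(1) by (simp add: frequent_def)
    qed
  qed
  also have "\<dots> = 2 ^ card H * k" by (simp add: card_Pow finite_H)
  finally show ?thesis .
qed

text \<open>
  Once the vertices outside \<open>H\<close> are chosen, those in \<open>H\<close> are distinct elements of the support, which has
  at most $k-1$ elements.
\<close>
lemma card_frequent_cycles:
  assumes "l < k"
  shows "card {p \<in> cycles (2 * l). hd p \<in> H \<and> (\<forall>y\<in>set p - H. frequent y)}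
    \<le> card {xs. length xs = l \<and> distinct xs \<and> set xs \<subseteq> {..<k - 1}} * card V ^ l"
proof -
  let ?G = "{p \<in> cycles (2 * l). hd p \<in> H \<and> (\<forall>y\<in>set p - H. frequent y)}"
  let ?L = "{ys. set ys \<subseteq> V \<and> length ys = l}"
  define D where "D ys = {xs. (length xs = l \<and> distinct xs \<and> set xs \<subseteq> \<Union> (nbrs ` set ys)) \<and> card (\<Union> (nbrs ` set ys)) < k}" for ys
  have finD: "finite (D ys)" for ys
    by (rule finite_subset[OF _ finite_lists_length_eq[of "\<Union> (nbrs ` set ys)" l]]) (auto simp: D_def)
  have "?G \<subseteq> (\<Union>ys\<in>?L. (\<lambda>xs. splice xs ys) ` D ys)"
  proof
    fix p assume p: "p \<in> ?G"
    then have p': "cycle_list E p" "length p = 2 * l" by (auto simp: cycles_def)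
    have "p \<in> cycles (2 * l)" "hd p \<in> H" using p by auto
    then obtain xs ys where xy: "p = splice xs ys" "length xs = l" "length ys = l" "distinct xs"
      "set xs \<subseteq> H" "set ys \<subseteq> V" "set p - H = set ys" "set p \<inter> H = set xs" "card (set ys) = l"
      "set xs \<subseteq> support p" by (rule split_cycle)
    have "card (support p) < k"
      by (rule support_small[OF p']) (use p xy assms in \<open>auto simp: distinct_card\<close>)
    then have "xs \<in> D ys" using xy(2,4,10) by (simp add: D_def support_def xy(7))
    then show "p \<in> (\<Union>ys\<in>?L. (\<lambda>xs. splice xs ys) ` D ys)" using xy(1,3,6) by auto
  qed
  then have "card ?G \<le> card (\<Union>ys\<in>?L. (\<lambda>xs. splice xs ys) ` D ys)"
    by (intro card_mono) (auto simp: finD finite_lists_length_eq finite_verts)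
  also have "\<dots> \<le> (\<Sum>ys\<in>?L. card ((\<lambda>xs. splice xs ys) ` D ys))"
    by (rule card_UN_le) (simp add: finite_lists_length_eq finite_verts)
  also have "\<dots> \<le> (\<Sum>ys\<in>?L. card {xs. length xs = l \<and> distinct xs \<and> set xs \<subseteq> {..<k - 1}})"
  proof (rule sum_mono)
    fix ys
    have "card ((\<lambda>xs. splice xs ys) ` D ys) \<le> card (D ys)" by (rule card_image_le[OF finD])
    also have "\<dots> \<le> card {xs. length xs = l \<and> distinct xs \<and> set xs \<subseteq> {..<k - 1}}"
    proof (cases "card (\<Union> (nbrs ` set ys)) < k")
      case True
      then have "D ys = {xs. length xs = l \<and> distinct xs \<and> set xs \<subseteq> \<Union> (nbrs ` set ys)}"
        by (simp add: D_def)
      moreover have "card {xs. length xs = l \<and> distinct xs \<and> set xs \<subseteq> \<Union> (nbrs ` set ys)}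
          \<le> card {xs. length xs = l \<and> distinct xs \<and> set xs \<subseteq> {..<k - 1}}"
        by (rule card_distinct_lists_mono) (use True in auto)
      ultimately show ?thesis by (simp only:)
    next
      case False
      then have "D ys = {}" by (simp add: D_def)
      then show ?thesis by (simp only: card.empty)
    qed
    finally show "card ((\<lambda>xs. splice xs ys) ` D ys) \<le> card {xs. length xs = l \<and> distinct xs \<and> set xs \<subseteq> {..<k - 1}}" .
  qed
  also have "\<dots> = card {xs. length xs = l \<and> distinct xs \<and> set xs \<subseteq> {..<k - 1}} * card V ^ l"
    by (simp add: card_lists_length_eq finite_verts)
  finally show ?thesis .
qed

lemma card_rare_cycles:
  "card {p \<in> cycles (2 * l). hd p \<in> H \<and> (\<exists>y\<in>set p - H. \<not> frequent y)}
    \<le> card H ^ l * (l * (2 ^ card H * k * card V ^ (l - 1)))"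
proof -
  let ?R = "{y \<in> V - H. \<not> frequent y}"
  let ?L = "{xs. set xs \<subseteq> H \<and> length xs = l}" and ?L' = "{qs. set qs \<subseteq> V \<and> length qs = l - 1}"
  let ?B = "{p \<in> cycles (2 * l). hd p \<in> H \<and> (\<exists>y\<in>set p - H. \<not> frequent y)}"
  let ?f = "\<lambda>(xs, i, r, qs). splice xs (take i qs @ r # drop i qs)"
  let ?A = "?L \<times> {..<l} \<times> ?R \<times> ?L'"
  have finA: "finite ?A" by (simp add: finite_lists_length_eq finite_verts finite_H)
  have "?B \<subseteq> ?f ` ?A"
  proof
    fix p assume p: "p \<in> ?B"
    have "p \<in> cycles (2 * l)" "hd p \<in> H" using p by auto
    then obtain xs ys where xy: "p = splice xs ys" "length xs = l" "length ys = l" "distinct xs"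
      "set xs \<subseteq> H" "set ys \<subseteq> V" "set p - H = set ys" "set p \<inter> H = set xs" "card (set ys) = l"
      "set xs \<subseteq> support p" by (rule split_cycle)
    obtain r where r: "r \<in> set ys" "\<not> frequent r" using p xy(7) by blast
    then obtain a b where ab: "ys = a @ r # b" by (metis split_list)
    have "r \<in> ?R" using r xy(6,7) by blast
    moreover have "length a < l" "a @ b \<in> ?L'" using ab xy(3,6) by auto
    ultimately have "(xs, length a, r, a @ b) \<in> ?A" using xy(2,5) by simp
    moreover have "p = ?f (xs, length a, r, a @ b)" using xy(1) ab by simp
    ultimately show "p \<in> ?f ` ?A" by (rule rev_image_eqI)
  qed
  then have "card ?B \<le> card (?f ` ?A)" by (rule card_mono[OF finite_imageI[OF finA]])
  also have "\<dots> \<le> card ?A" by (rule card_image_le[OF finA])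
  also have "\<dots> = card H ^ l * (l * (card ?R * card V ^ (l - 1)))"
    by (simp add: card_cartesian_product card_lists_length_eq finite_verts finite_H)
  also have "\<dots> \<le> card H ^ l * (l * (2 ^ card H * k * card V ^ (l - 1)))"
    by (intro mult_le_mono le_refl card_rare)
  finally show ?thesis .
qed

text \<open>
  The factor two accounts for the cycles that start outside \<open>H\<close>; one rotation makes them start in \<open>H\<close>.
\<close>
lemma card_split_cycles:
  assumes "1 \<le> l" "l < k"
  shows "card (cycles (2 * l)) \<le> 2 * (card {xs. length xs = l \<and> distinct xs \<and> set xs \<subseteq> {..<k - 1}} * card V ^ l
    + card H ^ l * (l * (2 ^ card H * k * card V ^ (l - 1))))"
proof -
  define A where "A = {p \<in> cycles (2 * l). hd p \<in> H}"
  have finA: "finite A" using finite_cycles by (auto simp: A_def)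
  have "cycles (2 * l) \<subseteq> A \<union> rotate (2 * l - 1) ` A"
  proof
    fix p assume "p \<in> cycles (2 * l)"
    then have p: "cycle_list E p" "length p = 2 * l" by (auto simp: cycles_def)
    show "p \<in> A \<union> rotate (2 * l - 1) ` A"
    proof (cases "hd p \<in> H")
      case True
      then show ?thesis using p by (simp add: A_def cycles_def)
    next
      case False
      obtain x y q where eq: "p = x # y # q" using p(2) assms(1) by (cases p; cases "tl p"; auto)
      have "E x y" using p(1) eq by (simp add: cycle_list_def)
      then have "y \<in> H" using split False eq by simp
      then have "rotate1 p \<in> A"
        using p cycle_list_rotate1[OF p(1)] eq by (simp add: A_def cycles_def)
      moreover have "rotate (2 * l - 1) (rotate1 p) = p"
        using p(2) assms(1) rotate_rotate[of "2 * l - 1" 1 p] by simp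
      ultimately show ?thesis by force
    qed
  qed
  then have "card (cycles (2 * l)) \<le> card (A \<union> rotate (2 * l - 1) ` A)"
    by (intro card_mono) (auto simp: finA)
  also have "\<dots> \<le> card A + card (rotate (2 * l - 1) ` A)" by (rule card_Un_le)
  also have "\<dots> \<le> 2 * card A" using card_image_le[OF finA, of "rotate (2 * l - 1)"] by simp
  also have "card A \<le> card {p \<in> cycles (2 * l). hd p \<in> H \<and> (\<forall>y\<in>set p - H. frequent y)}
      + card {p \<in> cycles (2 * l). hd p \<in> H \<and> (\<exists>y\<in>set p - H. \<not> frequent y)}"
    unfolding A_def by (rule order_trans[OF card_mono card_Un_le]) (auto simp: finite_cycles)
  also have "\<dots> \<le> card {xs. length xs = l \<and> distinct xs \<and> set xs \<subseteq> {..<k - 1}} * card V ^ l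
    + card H ^ l * (l * (2 ^ card H * k * card V ^ (l - 1)))"
    by (rule add_mono[OF card_frequent_cycles[OF assms(2)] card_rare_cycles])
  finally show ?thesis by simp
qed

end

section \<open>Asymptotic upper bound\<close>

lemma cycle_list_nth:
  "cycle_list E p \<longleftrightarrow> p \<noteq> [] \<and> distinct p \<and> (\<forall>i<length p. E (p ! i) (p ! (Suc i mod length p)))"
proof (cases "p = []")
  case False
  have "successively E (p @ [hd p]) \<longleftrightarrow> (\<forall>i<length p. E (p ! i) (p ! (Suc i mod length p)))"
  proof -
    have "(p @ [hd p]) ! Suc i = p ! (Suc i mod length p)" if "i < length p" for i
    proof (cases "Suc i = length p")
      case True
      then show ?thesis using False by (simp add: nth_append hd_conv_nth)
    next
      case False
      then have "Suc i < length p" using that by simp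
      then show ?thesis by (simp add: nth_append)
    qed
    moreover have "(p @ [hd p]) ! i = p ! i" if "i < length p" for i
      using that by (simp add: nth_append)
    ultimately show ?thesis unfolding successively_conv_nth by auto
  qed
  then show ?thesis using False by (simp add: cycle_list_def)
qed (simp add: cycle_list_def)

lemma powr_inverse_power:
  assumes "0 < m" "0 \<le> x"
  shows "(x powr (1 / real m)) ^ m = x"
proof (cases "x = 0")
  case False
  then have "(x powr (1 / real m)) ^ m = (x powr (1 / real m)) powr real m"
    using assms(2) by (simp add: powr_realpow)
  then show ?thesis using assms False by (simp add: powr_powr)
qed (use assms in simp)

context cycle_free_graph
begin

lemma sum_deg_real:
  "real (\<Sum>v\<in>V. deg v) \<le> 36 * real k * real (card V) powr (4 / 3)"
proof -
  define x where "x = 18 * real k * real (card V) powr (1 / 3)"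
  define c where "c = nat \<lfloor>x\<rfloor>"
  have x: "0 \<le> x" by (simp add: x_def)
  have "x < real (Suc c)" using x by (simp add: c_def) linarith
  then have "x ^ 3 < real (Suc c) ^ 3" using x by (intro power_strict_mono) auto
  moreover have "(real (card V) powr (1 / 3)) ^ 3 = real (card V)"
    using powr_inverse_power[of 3 "real (card V)"] by simp
  ultimately have "real ((18 * k) ^ 3 * card V) < real (Suc c ^ 3)"
    by (simp add: x_def power_mult_distrib)
  then have "(18 * k) ^ 3 * card V < Suc c ^ 3" by (simp only: of_nat_less_iff)
  then have "(\<Sum>v\<in>V. deg v) \<le> 2 * c * card V" by (rule sum_deg_le)
  then have "real (\<Sum>v\<in>V. deg v) \<le> real (2 * c * card V)" by (rule of_nat_mono)
  also have "\<dots> \<le> 2 * x * real (card V)"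
    using x by (simp add: c_def mult_right_mono)
  also have "\<dots> = 36 * real k * (real (card V) powr (1 / 3) * real (card V) powr 1)"
    by (simp add: x_def)
  also have "\<dots> = 36 * real k * real (card V) powr (4 / 3)"
    by (simp only: powr_add[symmetric]) simp
  finally show ?thesis .
qed

lemma sum_deg_square_real:
  assumes D: "\<And>v. v \<in> V \<Longrightarrow> deg v \<le> D"
  shows "real (\<Sum>v\<in>V. (deg v)\<^sup>2)
    \<le> 216 * (real k)\<^sup>2 * real (card V) powr (11 / 6) + 4 * real k * real (card V) * real D"
proof (cases "card V = 0")
  case True
  then have "V = {}" using finite_verts by simp
  then show ?thesis by simp
next
  case False
  define x where "x = real k * sqrt (real (card V))"
  \<comment> \<open>The factor 5 gives $T^2 \<ge> 25k^2n \<ge> 18k^2n$; it leaves room for rounding up below $6x$.\<close>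
  define T where "T = nat \<lceil>5 * x\<rceil>"
  have x1: "1 \<le> x"
    unfolding x_def using mult_mono[of 1 "real k" 1 "sqrt (real (card V))"] k_ge False by simp
  have T: "5 * x \<le> real T" "real T \<le> 6 * x"
    using x1 unfolding T_def by linarith+
  have "18 * (real k)\<^sup>2 * real (card V) \<le> (5 * x)\<^sup>2"
    by (simp add: x_def power_mult_distrib)
  also have "\<dots> \<le> (real T)\<^sup>2" using T(1) x1 by (intro power_mono) auto
  finally have "real (18 * k\<^sup>2 * card V) \<le> real (T\<^sup>2)" by simp
  then have "18 * k\<^sup>2 * card V \<le> T\<^sup>2" by (simp only: of_nat_le_iff)
  from sum_deg_square_le[OF this D]
  have "real (\<Sum>v\<in>V. (deg v)\<^sup>2) \<le> real (T * (\<Sum>v\<in>V. deg v) + 4 * k * card V * D)"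
    by (intro of_nat_mono) auto
  also have "\<dots> = real T * real (\<Sum>v\<in>V. deg v) + 4 * real k * real (card V) * real D"
    by simp
  also have "real T * real (\<Sum>v\<in>V. deg v) \<le> (6 * x) * (36 * real k * real (card V) powr (4 / 3))"
    by (rule mult_mono[OF T(2) sum_deg_real]) (use x1 in \<open>auto intro: sum_nonneg\<close>)
  also have "\<dots> = 216 * (real k)\<^sup>2 * (real (card V) powr (1 / 2) * real (card V) powr (4 / 3))"
    by (simp add: x_def powr_half_sqrt power2_eq_square)
  also have "\<dots> = 216 * (real k)\<^sup>2 * real (card V) powr (11 / 6)"
    by (simp only: powr_add[symmetric]) simp
  finally show ?thesis by simp
qed

lemma sum_codeg_square_real:
  assumes D: "\<And>v. v \<in> V \<Longrightarrow> deg v \<le> D"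
  shows "(\<Sum>u\<in>V. \<Sum>v\<in>V. (real (codeg u v))\<^sup>2)
    \<le> 8 * real k * (216 * (real k)\<^sup>2 * real (card V) powr (11 / 6) + 4 * real k * real (card V) * real D)"
proof -
  have "(\<Sum>u\<in>V. \<Sum>v\<in>V. (real (codeg u v))\<^sup>2) = real (\<Sum>(u, v)\<in>V \<times> V. (codeg u v)\<^sup>2)"
    by (simp add: sum.cartesian_product case_prod_unfold)
  also have "\<dots> \<le> real (8 * k * (\<Sum>v\<in>V. (deg v)\<^sup>2))"
    by (rule of_nat_mono[OF sum_codeg_square_le])
  also have "\<dots> = 8 * real k * real (\<Sum>v\<in>V. (deg v)\<^sup>2)" by simp
  also have "\<dots> \<le> 8 * real k * (216 * (real k)\<^sup>2 * real (card V) powr (11 / 6) + 4 * real k * real (card V) * real D)"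
    by (rule mult_left_mono[OF sum_deg_square_real[OF D]]) auto
  finally show ?thesis .
qed

text \<open>
  Here \<open>c\<close> is chosen such that $\sum \mathrm{codeg}^2 \le (cn)^2$ holds in every $C_{2k}$-free graph, and
  $\varepsilon$ such that $\sum \mathrm{codeg}^2 \le (\delta n)^2$ holds for the edges within the two
  classes. The conditions on \<open>card V\<close> make the lower-order terms of these bounds negligible.
\<close>
lemma card_cycles_upper:
  fixes l :: nat and \<delta> \<epsilon> c :: real
  defines "c \<equiv> sqrt (1760 * real k ^ 3)"
  assumes l: "2 \<le> l" "l < k" and \<delta>: "0 < \<delta>" and \<epsilon>: "\<epsilon> = \<delta>\<^sup>2 / (40 * (real k)\<^sup>2)"
    and M: "2 * real k / \<epsilon> < real M + 1"
    and n: "18 * (real k)\<^sup>2 / \<epsilon>\<^sup>2 \<le> real (card V)" "real M / \<epsilon> \<le> real (card V)"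
      "(216 * real k / \<epsilon>) ^ 6 \<le> real (card V)" "0 < card V"
  shows "real (card (cycles (2 * l)))
    \<le> 2 * (real (card {xs. length xs = l \<and> distinct xs \<and> set xs \<subseteq> {..<k - 1}}) * real (card V) ^ l
        + real (M ^ l * l * 2 ^ M * k) * real (card V) ^ (l - 1))
      + 2 * real l * sqrt (\<delta> * c) * c ^ (l - 1) * real (card V) ^ l"
proof -
  let ?n = "real (card V)"
  have k: "0 < real k" using k_ge by simp
  have n1: "1 \<le> ?n" using n(4) by simp
  have \<epsilon>0: "0 < \<epsilon>" using \<epsilon> \<delta> k by simp
  have c: "c\<^sup>2 = 1760 * real k ^ 3" "0 \<le> c" by (simp_all add: c_def)
  define D0 where "D0 = nat \<lceil>\<epsilon> * ?n\<rceil>"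
  define H where "H = {v \<in> V. D0 \<le> deg v}"
  have D0: "\<epsilon> * ?n \<le> real D0" unfolding D0_def by linarith
  have finH: "finite H" using finite_verts by (simp add: H_def)
  have "18 * (real k)\<^sup>2 * ?n \<le> \<epsilon>\<^sup>2 * ?n * ?n"
    using mult_right_mono[OF n(1), of "\<epsilon>\<^sup>2 * ?n"] \<epsilon>0 n1 by (simp add: field_simps)
  also have "\<dots> = (\<epsilon> * ?n)\<^sup>2" by (simp add: power2_eq_square)
  also have "\<dots> \<le> (real D0)\<^sup>2" using D0 \<epsilon>0 n1 by (intro power_mono) auto
  finally have "real (18 * k\<^sup>2 * card V) \<le> real (D0\<^sup>2)" by simp
  then have "18 * k\<^sup>2 * card V \<le> D0\<^sup>2" by (simp only: of_nat_le_iff)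
  then have "D0 * card H \<le> 2 * k * card V" unfolding H_def by (rule few_high_degree)
  then have "real (D0 * card H) \<le> real (2 * k * card V)" by (rule of_nat_mono)
  then have "\<epsilon> * ?n * real (card H) \<le> 2 * real k * ?n"
    using mult_right_mono[OF D0, of "real (card H)"] by simp
  then have "\<epsilon> * real (card H) * ?n \<le> 2 * real k * ?n" by (simp add: mult_ac)
  then have "\<epsilon> * real (card H) \<le> 2 * real k" using n1 by simp
  then have "real (card H) \<le> 2 * real k / \<epsilon>" using \<epsilon>0 by (simp add: field_simps)
  then have HM: "card H \<le> M" using M by linarith
  define S where "S x y \<longleftrightarrow> E x y \<and> (x \<in> H \<longleftrightarrow> y \<in> H)" for x y
  define B where "B x y \<longleftrightarrow> E x y \<and> (x \<in> H \<longleftrightarrow> y \<notin> H)" for x y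
  interpret S: cycle_free_graph V S k
  proof
    fix p assume "cycle_list S p"
    then have "cycle_list E p" by (rule cycle_list_mono) (simp add: S_def)
    then show "length p \<noteq> 2 * k" by (rule no_cycle)
  qed (use finite_verts adj_sym adj_irrefl adj_verts k_ge in \<open>auto simp: S_def\<close>)
  interpret B: split_graph V B k H
  proof
    fix p assume "cycle_list B p"
    then have "cycle_list E p" by (rule cycle_list_mono) (simp add: B_def)
    then show "length p \<noteq> 2 * k" by (rule no_cycle)
  next
    fix x y assume "B x y" then show "B y x" using adj_sym by (auto simp: B_def)
  qed (use finite_verts adj_irrefl adj_verts k_ge in \<open>auto simp: B_def H_def\<close>)
  interpret ES: fin_graph_with_subgraph V E S
    by unfold_locales (simp add: S_def)
  have degS: "S.deg v \<le> nat \<lfloor>\<epsilon> * ?n\<rfloor>" if v: "v \<in> V" for v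
  proof (cases "v \<in> H")
    case True
    then have "S.nbrs v \<subseteq> H" by (auto simp: S_def)
    then have "S.deg v \<le> M" using card_mono[OF finH] HM le_trans unfolding S.deg_def by blast
    moreover have "real M \<le> \<epsilon> * ?n" using n(2) \<epsilon>0 by (simp add: field_simps)
    ultimately show ?thesis by linarith
  next
    case False
    then have "deg v < D0" using v by (simp add: H_def)
    moreover have "S.nbrs v \<subseteq> nbrs v" by (auto simp: S_def)
    then have "S.deg v \<le> deg v" unfolding S.deg_def deg_def by (rule card_mono[OF finite_nbrs])
    ultimately show ?thesis unfolding D0_def by linarith
  qed
  have pw: "?n powr (11 / 6) \<le> ?n\<^sup>2"
    using powr_mono[of "11/6" 2 ?n] n1 by simp
  have "(\<Sum>u\<in>V. \<Sum>v\<in>V. (real (codeg u v))\<^sup>2) \<le> 8 * real k * (216 * (real k)\<^sup>2 * ?n powr (11 / 6) + 4 * real k * ?n * ?n)"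
    by (rule sum_codeg_square_real[OF deg_le])
  also have "\<dots> \<le> 8 * real k * (216 * (real k)\<^sup>2 * ?n\<^sup>2 + 4 * (real k)\<^sup>2 * ?n\<^sup>2)"
  proof (intro mult_left_mono add_mono)
    have "real k * (?n * ?n) \<le> (real k)\<^sup>2 * (?n * ?n)"
      using k_ge by (intro mult_right_mono) (auto simp: power2_eq_square)
    then show "4 * real k * ?n * ?n \<le> 4 * (real k)\<^sup>2 * ?n\<^sup>2" by (simp add: power2_eq_square)
  qed (use pw in auto)
  also have "\<dots> = (c * ?n)\<^sup>2"
    by (simp add: c power_mult_distrib) (simp add: power2_eq_square power3_eq_cube)
  finally have C4: "(\<Sum>u\<in>V. \<Sum>v\<in>V. (real (codeg u v))\<^sup>2) \<le> (c * ?n)\<^sup>2" .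
  have "(\<Sum>u\<in>V. \<Sum>v\<in>V. (real (S.codeg u v))\<^sup>2)
      \<le> 8 * real k * (216 * (real k)\<^sup>2 * ?n powr (11 / 6) + 4 * real k * ?n * real (nat \<lfloor>\<epsilon> * ?n\<rfloor>))"
    by (rule S.sum_codeg_square_real[OF degS])
  also have "\<dots> \<le> 8 * real k * (real k * \<epsilon> * ?n\<^sup>2 + 4 * real k * ?n * (\<epsilon> * ?n))"
  proof (intro mult_left_mono add_mono)
    have "216 * real k / \<epsilon> \<le> ?n powr (1 / 6)"
    proof -
      have "(216 * real k / \<epsilon>) ^ 6 \<le> (?n powr (1 / 6)) ^ 6"
        using n(3) powr_inverse_power[of 6 ?n] by simp
      then show ?thesis by (rule power_le_imp_le_base[of _ 5, simplified]) simp
    qed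
    then have "216 * real k * ?n powr (11 / 6) \<le> \<epsilon> * ?n powr (1 / 6) * ?n powr (11 / 6)"
      using \<epsilon>0 by (intro mult_right_mono) (auto simp: field_simps)
    also have "\<dots> = \<epsilon> * (?n powr (1 / 6) * ?n powr (11 / 6))" by simp
    also have "?n powr (1 / 6) * ?n powr (11 / 6) = ?n\<^sup>2"
      using n1 by (simp only: powr_add[symmetric]) simp
    finally have "real k * (216 * real k * ?n powr (11 / 6)) \<le> real k * (\<epsilon> * ?n\<^sup>2)"
      using k by (intro mult_left_mono) auto
    then show "216 * (real k)\<^sup>2 * ?n powr (11 / 6) \<le> real k * \<epsilon> * ?n\<^sup>2"
      by (simp add: power2_eq_square mult_ac)
    show "real (nat \<lfloor>\<epsilon> * ?n\<rfloor>) \<le> \<epsilon> * ?n" using \<epsilon>0 n1 by simp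
  qed (use k in auto)
  also have "\<dots> = (\<delta> * ?n)\<^sup>2"
    using k by (simp add: \<epsilon> power_mult_distrib) (simp add: field_simps power2_eq_square)
  finally have D4: "(\<Sum>u\<in>V. \<Sum>v\<in>V. (real (S.codeg u v))\<^sup>2) \<le> (\<delta> * ?n)\<^sup>2" .
  let ?bad = "{p \<in> cycles (2 * l). \<exists>i<2 * l. S (p ! i) (p ! (Suc i mod (2 * l)))}"
  have "cycles (2 * l) \<subseteq> B.cycles (2 * l) \<union> ?bad"
  proof
    fix p assume p: "p \<in> cycles (2 * l)"
    show "p \<in> B.cycles (2 * l) \<union> ?bad"
    proof (cases "\<exists>i<2 * l. S (p ! i) (p ! (Suc i mod (2 * l)))")
      case False
      have p': "cycle_list E p" "length p = 2 * l" using p by (simp_all add: cycles_def)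
      have "B (p ! i) (p ! (Suc i mod length p))" if i: "i < length p" for i
      proof -
        have "E (p ! i) (p ! (Suc i mod length p))" using p'(1) i by (simp add: cycle_list_nth)
        moreover have "\<not> S (p ! i) (p ! (Suc i mod length p))" using False i p'(2) by metis
        ultimately show ?thesis by (simp add: S_def B_def)
      qed
      then have "cycle_list B p" using p'(1) unfolding cycle_list_nth by blast
      then show ?thesis using p'(2) by (simp add: B.cycles_def)
    next
      case True
      with p show ?thesis by simp
    qed
  qed
  then have "card (cycles (2 * l)) \<le> card (B.cycles (2 * l) \<union> ?bad)"
    by (intro card_mono) (auto simp: B.finite_cycles finite_cycles)
  also have "\<dots> \<le> card (B.cycles (2 * l)) + card ?bad" by (rule card_Un_le)
  finally have "real (card (cycles (2 * l))) \<le> real (card (B.cycles (2 * l))) + real (card ?bad)"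
    by (simp only: of_nat_add[symmetric] of_nat_le_iff)
  moreover have "real (card ?bad) \<le> 2 * real l * (sqrt (\<delta> * ?n * (c * ?n)) * (c * ?n) ^ (l - 1))"
    by (rule ES.cycles_meeting_subgraph[OF l(1) C4 _ D4]) (use c \<delta> in auto)
  moreover have "2 * real l * (sqrt (\<delta> * ?n * (c * ?n)) * (c * ?n) ^ (l - 1))
      = 2 * real l * sqrt (\<delta> * c) * c ^ (l - 1) * ?n ^ l"
  proof -
    have "sqrt (\<delta> * ?n * (c * ?n)) = sqrt (\<delta> * c * ?n\<^sup>2)" by (simp add: power2_eq_square mult_ac)
    also have "\<dots> = sqrt (\<delta> * c) * ?n" by (simp add: real_sqrt_mult)
    finally have *: "sqrt (\<delta> * ?n * (c * ?n)) = sqrt (\<delta> * c) * ?n" .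
    have "?n ^ l = ?n * ?n ^ (l - 1)" using l(1) by (simp add: power_eq_if)
    then show ?thesis unfolding * by (simp add: power_mult_distrib mult_ac)
  qed
  moreover have "real (card (B.cycles (2 * l)))
      \<le> 2 * (real (card {xs. length xs = l \<and> distinct xs \<and> set xs \<subseteq> {..<k - 1}}) * ?n ^ l
        + real (M ^ l * l * 2 ^ M * k) * ?n ^ (l - 1))"
  proof -
    let ?F = "card {xs. length xs = l \<and> distinct xs \<and> set xs \<subseteq> {..<k - 1}}"
    have "card (B.cycles (2 * l)) \<le> 2 * (?F * card V ^ l + card H ^ l * (l * (2 ^ card H * k * card V ^ (l - 1))))"
      by (rule B.card_split_cycles) (use l in auto)
    also have "\<dots> \<le> 2 * (?F * card V ^ l + M ^ l * (l * (2 ^ M * k * card V ^ (l - 1))))"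
      using HM by (intro mult_le_mono add_le_mono le_refl power_mono power_increasing) auto
    finally have "real (card (B.cycles (2 * l))) \<le> real (2 * (?F * card V ^ l + M ^ l * (l * (2 ^ M * k * card V ^ (l - 1)))))"
      by (rule of_nat_mono)
    then show ?thesis by (simp add: mult_ac)
  qed
  ultimately show ?thesis by linarith
qed

end

text \<open>
  The threshold depends on $k$, $\ell$ and \<open>\<eta>\<close> only, not on the graph: first $\delta$ and
  $\varepsilon$ are fixed, which bounds the number of heavy vertices, and then $n$ is taken large.
\<close>
lemma eventually_few_cycles:
  fixes k l :: nat and \<eta> :: real
  assumes l: "2 \<le> l" "l < k" and \<eta>: "0 < \<eta>"
  shows "\<exists>n0. \<forall>(V :: 'a set) E. cycle_free_graph V E k \<longrightarrow> n0 \<le> card V \<longrightarrow>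
    real (card (fin_graph.cycles E (2 * l)))
      \<le> (2 * real (card {xs. length xs = l \<and> distinct xs \<and> set xs \<subseteq> {..<k - 1}}) + \<eta>) * real (card V) ^ l"
proof -
  have k: "0 < real k" "0 < real l" using l by auto
  define c where "c = sqrt (1760 * real k ^ 3)"
  have c: "0 < c" using k by (simp add: c_def)
  \<comment> \<open>With $\sqrt{\delta c} = x$ the cycles that do not alternate contribute at most $(\eta/2)\,n^\ell$.\<close>
  define x where "x = \<eta> / (4 * real l * c ^ (l - 1))"
  define \<delta> where "\<delta> = x\<^sup>2 / c"
  define \<epsilon> where "\<epsilon> = \<delta>\<^sup>2 / (40 * (real k)\<^sup>2)"
  define M where "M = nat \<lfloor>2 * real k / \<epsilon>\<rfloor>"
  define K where "K = real (M ^ l * l * 2 ^ M * k)"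
  have x: "0 < x" using \<eta> c k by (simp add: x_def)
  have \<delta>: "0 < \<delta>" "sqrt (\<delta> * c) = x" using x c by (simp_all add: \<delta>_def)
  have \<epsilon>: "0 < \<epsilon>" using \<delta>(1) k by (simp add: \<epsilon>_def)
  have M: "2 * real k / \<epsilon> < real M + 1" using \<epsilon> k unfolding M_def by linarith
  define n0 where "n0 = Suc (nat \<lceil>18 * (real k)\<^sup>2 / \<epsilon>\<^sup>2\<rceil> + nat \<lceil>real M / \<epsilon>\<rceil> + nat \<lceil>(216 * real k / \<epsilon>) ^ 6\<rceil>
    + nat \<lceil>4 * K / \<eta>\<rceil>)"
  show ?thesis
  proof (intro exI allI impI)
    fix V :: "'a set" and E
    assume G: "cycle_free_graph V E k" and n: "n0 \<le> card V"
    interpret cycle_free_graph V E k by (rule G)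
    let ?n = "real (card V)" and ?F = "real (card {xs. length xs = l \<and> distinct xs \<and> set xs \<subseteq> {..<k - 1}})"
    have big: "18 * (real k)\<^sup>2 / \<epsilon>\<^sup>2 \<le> ?n" "real M / \<epsilon> \<le> ?n" "(216 * real k / \<epsilon>) ^ 6 \<le> ?n"
        "4 * K / \<eta> \<le> ?n" "0 < card V"
      using n unfolding n0_def by linarith+
    have "real (card (cycles (2 * l))) \<le> 2 * (?F * ?n ^ l + K * ?n ^ (l - 1)) + 2 * real l * sqrt (\<delta> * c) * c ^ (l - 1) * ?n ^ l"
      unfolding K_def c_def by (rule card_cycles_upper[OF l \<delta>(1) \<epsilon>_def M big(1,2,3,5)])
    also have "2 * real l * sqrt (\<delta> * c) * c ^ (l - 1) = \<eta> / 2"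
      using c k by (simp add: \<delta>(2) x_def field_simps)
    also have "2 * (?F * ?n ^ l + K * ?n ^ (l - 1)) + \<eta> / 2 * ?n ^ l \<le> (2 * ?F + \<eta>) * ?n ^ l"
    proof -
      have "?n ^ l = ?n * ?n ^ (l - 1)" using l(1) by (simp add: power_eq_if)
      moreover have "4 * K \<le> \<eta> * ?n" using big(4) \<eta> by (simp add: field_simps)
      then have "4 * K * ?n ^ (l - 1) \<le> \<eta> * ?n * ?n ^ (l - 1)" by (intro mult_right_mono) auto
      ultimately have "4 * K * ?n ^ (l - 1) \<le> \<eta> * ?n ^ l" by (simp add: mult_ac)
      then show ?thesis by (simp add: algebra_simps)
    qed
    finally show "real (card (cycles (2 * l))) \<le> (2 * ?F + \<eta>) * ?n ^ l" .
  qed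
qed

section \<open>Copies of a cycle as lists of vertices\<close>

definition adj :: "'a graph \<Rightarrow> 'a \<Rightarrow> 'a \<Rightarrow> bool" where
  "adj G x y \<longleftrightarrow> {x, y} \<in> edges G"

definition graph_of_list :: "'a list \<Rightarrow> 'a graph" where
  "graph_of_list p = Graph (set p) {{p ! i, p ! (Suc i mod length p)} | i. i < length p}"

lemma adj_commute: "adj G x y \<longleftrightarrow> adj G y x"
  by (simp add: adj_def insert_commute)

lemma simple_graph_adj:
  assumes "simple_graph G" "adj G x y"
  shows "x \<in> verts G" "y \<in> verts G" "x \<noteq> y"
  using assms unfolding simple_graph_def adj_def by (force dest: bspec)+

lemma fin_graph_adj:
  assumes "simple_graph G" shows "fin_graph (verts G) (adj G)"
proof
  show "finite (verts G)" using assms by (simp add: simple_graph_def)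
qed (use simple_graph_adj[OF assms] adj_commute[of G] in blast)+

lemma cycle_list_adj_iff:
  "cycle_list (adj G) p \<longleftrightarrow> p \<noteq> [] \<and> distinct p \<and> edges (graph_of_list p) \<subseteq> edges G"
  by (auto simp: cycle_list_nth adj_def graph_of_list_def)

lemma edges_rotate_subset: "edges (graph_of_list (rotate j p)) \<subseteq> edges (graph_of_list p)"
proof
  fix e assume "e \<in> edges (graph_of_list (rotate j p))"
  then obtain i where i: "i < length p" "e = {rotate j p ! i, rotate j p ! (Suc i mod length p)}"
    by (auto simp: graph_of_list_def)
  have "Suc i mod length p < length p" using i(1) by (intro mod_less_divisor) linarith
  then have "rotate j p ! (Suc i mod length p) = p ! (Suc ((j + i) mod length p) mod length p)"
    by (simp add: nth_rotate mod_simps)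
  then have "e = {p ! ((j + i) mod length p), p ! (Suc ((j + i) mod length p) mod length p)}"
    using i by (simp add: nth_rotate)
  moreover have "(j + i) mod length p < length p" using i(1) by (intro mod_less_divisor) linarith
  ultimately show "e \<in> edges (graph_of_list p)" unfolding graph_of_list_def by auto
qed

lemma graph_of_list_rotate:
  assumes "j \<le> length p" shows "graph_of_list (rotate j p) = graph_of_list p"
proof -
  have "rotate (length p - j) (rotate j p) = p" using assms by (simp add: rotate_rotate)
  then have "edges (graph_of_list p) \<subseteq> edges (graph_of_list (rotate j p))"
    using edges_rotate_subset[of "length p - j" "rotate j p"] by simp
  with edges_rotate_subset[of j p] have "edges (graph_of_list (rotate j p)) = edges (graph_of_list p)" by simp
  then show ?thesis by (simp add: graph_of_list_def)
qed

lemma edges_rev_subset: "edges (graph_of_list (rev p)) \<subseteq> edges (graph_of_list p)"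
proof
  fix e assume "e \<in> edges (graph_of_list (rev p))"
  then obtain i where i: "i < length p" "e = {rev p ! i, rev p ! (Suc i mod length p)}"
    by (auto simp: graph_of_list_def)
  show "e \<in> edges (graph_of_list p)"
  proof (cases "Suc i = length p")
    case True
    have "length p - Suc 0 = i" "0 < length p" "length p - Suc i = 0" using True by linarith+
    then have "rev p ! 0 = p ! i" "rev p ! i = p ! 0"
      using i(1) rev_nth[of 0 p] rev_nth[of i p] by simp_all
    moreover have "Suc i mod length p = 0" using True by simp
    ultimately have "e = {p ! i, p ! (Suc i mod length p)}" unfolding i(2) by (simp add: insert_commute)
    then show ?thesis using i(1) by (auto simp: graph_of_list_def)
  next
    case False
    define a where "a = length p - Suc (Suc i)"
    have a: "a < length p" "Suc a = length p - Suc i" "Suc a mod length p = Suc a"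
      using i(1) False unfolding a_def by auto
    have "e = {p ! a, p ! (Suc a mod length p)}" using i False a by (auto simp: rev_nth a_def)
    then show ?thesis using a(1) by (auto simp: graph_of_list_def)
  qed
qed

lemma graph_of_list_rev: "graph_of_list (rev p) = graph_of_list p"
proof -
  have "edges (graph_of_list (rev p)) = edges (graph_of_list p)"
    using edges_rev_subset[of p] edges_rev_subset[of "rev p"] by simp
  then show ?thesis by (simp add: graph_of_list_def)
qed

lemma Suc_mod_neq:
  assumes "3 \<le> m" "i < (m :: nat)"
  shows "Suc i mod m \<noteq> i" "Suc (Suc i mod m) mod m \<noteq> i"
  using assms by (auto simp: mod_Suc)

lemma graph_of_list_copy:
  assumes G: "simple_graph G" and p: "cycle_list (adj G) p" "length p = m" and m: "3 \<le> m"
  shows "graph_of_list p \<in> copies (cycle_graph m) G"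
proof -
  have d: "distinct p" and sub: "edges (graph_of_list p) \<subseteq> edges G"
    using p(1) by (auto simp: cycle_list_adj_iff)
  interpret fin_graph "verts G" "adj G" by (rule fin_graph_adj[OF G])
  have lt: "Suc i mod m < m" for i using m by simp
  have "simple_graph (graph_of_list p)"
    unfolding simple_graph_def
  proof (intro conjI ballI)
    fix e assume e: "e \<in> edges (graph_of_list p)"
    then show "card e = 2" using sub G by (auto simp: simple_graph_def)
    obtain i where "i < m" "e = {p ! i, p ! (Suc i mod m)}" using e p(2) by (auto simp: graph_of_list_def)
    then show "e \<subseteq> verts (graph_of_list p)" using lt[of i] p(2) by (auto simp: graph_of_list_def)
  qed (simp add: graph_of_list_def)
  then have "subgraph (graph_of_list p) G"
    using cycle_verts[OF p(1)] sub by (simp add: subgraph_def graph_of_list_def)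
  moreover have "graph_iso (graph_of_list p) (cycle_graph m)"
    unfolding graph_iso_def
  proof (intro exI conjI ballI)
    have bij: "bij_betw ((!) p) {..<m} (set p)" using d p(2) by (intro bij_betw_nth) auto
    let ?f = "the_inv_into {..<m} ((!) p)"
    show "bij_betw ?f (verts (graph_of_list p)) (verts (cycle_graph m))"
      using bij_betw_the_inv_into[OF bij] by (simp add: graph_of_list_def cycle_graph_def)
    fix x y assume "x \<in> verts (graph_of_list p)" "y \<in> verts (graph_of_list p)"
    then obtain i j where ij: "i < m" "x = p ! i" "j < m" "y = p ! j"
      using p(2) by (auto simp: graph_of_list_def in_set_conv_nth)
    have f: "?f x = i" "?f y = j" using ij bij by (auto simp: the_inv_into_f_f bij_betw_def)
    have "({p ! i, p ! j} = {p ! a, p ! (Suc a mod m)}) = ({i, j} = {a, Suc a mod m})" if "a < m" for a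
      using ij that lt[of a] d p(2) by (simp add: doubleton_eq_iff nth_eq_iff_index_eq)
    then have "({p ! i, p ! j} \<in> edges (graph_of_list p)) = ({i, j} \<in> edges (cycle_graph m))"
      unfolding graph_of_list_def cycle_graph_def p(2) graph.sel mem_Collect_eq by blast
    then show "({x, y} \<in> edges (graph_of_list p)) = ({?f x, ?f y} \<in> edges (cycle_graph m))"
      unfolding f by (simp only: ij(2,4))
  qed
  ultimately show ?thesis by (simp add: copies_def)
qed

lemma copy_is_graph_of_list:
  assumes S: "S \<in> copies (cycle_graph m) G" and m: "3 \<le> m"
  shows "\<exists>p. cycle_list (adj G) p \<and> length p = m \<and> graph_of_list p = S"
proof -
  have simple: "simple_graph S" and sub: "edges S \<subseteq> edges G"
    using S by (auto simp: copies_def subgraph_def)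
  obtain f where f: "bij_betw f (verts S) {..<m}"
    and iso: "\<And>x y. x \<in> verts S \<Longrightarrow> y \<in> verts S \<Longrightarrow> {x, y} \<in> edges S \<longleftrightarrow> {f x, f y} \<in> edges (cycle_graph m)"
    using S by (auto simp: copies_def graph_iso_def cycle_graph_def)
  define g where "g = the_inv_into (verts S) f"
  have g: "bij_betw g {..<m} (verts S)" unfolding g_def by (rule bij_betw_the_inv_into[OF f])
  have fg: "f (g i) = i" if "i < m" for i
    unfolding g_def by (rule f_the_inv_into_f_bij_betw[OF f]) (use that in simp)
  have gf: "g (f x) = x" if "x \<in> verts S" for x
    unfolding g_def by (rule the_inv_into_f_f) (use f that in \<open>auto simp: bij_betw_def\<close>)
  have gV: "g i \<in> verts S" if "i < m" for i using g that by (auto simp: bij_betw_def)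
  define p where "p = map g [0..<m]"
  have len: "length p = m" by (simp add: p_def)
  have nth: "p ! i = g i" if "i < m" for i using that by (simp add: p_def)
  have lt: "Suc i mod m < m" for i using m by simp
  have "set p = verts S" using g by (auto simp: p_def bij_betw_def lessThan_atLeast0)
  moreover have "edges (graph_of_list p) = edges S"
  proof
    show "edges (graph_of_list p) \<subseteq> edges S"
    proof
      fix e assume "e \<in> edges (graph_of_list p)"
      then obtain i where i: "i < m" "e = {g i, g (Suc i mod m)}"
        using nth lt by (auto simp: graph_of_list_def len)
      then have "{f (g i), f (g (Suc i mod m))} \<in> edges (cycle_graph m)"
        using fg lt by (auto simp: cycle_graph_def)
      then show "e \<in> edges S" using iso gV i lt by simp
    qed
    show "edges S \<subseteq> edges (graph_of_list p)"
    proof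
      fix e assume e: "e \<in> edges S"
      then obtain x y where xy: "e = {x, y}" "x \<in> verts S" "y \<in> verts S"
        using simple unfolding simple_graph_def card_2_iff by (metis insert_subset)
      then have "{f x, f y} \<in> edges (cycle_graph m)" using iso e by simp
      then obtain i where i: "i < m" "{f x, f y} = {i, Suc i mod m}" by (auto simp: cycle_graph_def)
      have "e = g ` {f x, f y}" using xy gf by simp
      also have "\<dots> = {p ! i, p ! (Suc i mod m)}" using i nth lt by simp
      finally show "e \<in> edges (graph_of_list p)" using i(1) by (auto simp: graph_of_list_def len)
    qed
  qed
  ultimately have "graph_of_list p = S" by (cases S) (simp add: graph_of_list_def)
  moreover have "distinct p" using g by (simp add: p_def distinct_map bij_betw_def lessThan_atLeast0)
  moreover have "p \<noteq> []" using len m by auto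
  ultimately show ?thesis using len sub by (intro exI[of _ p]) (simp add: cycle_list_adj_iff)
qed

lemma graph_of_list_neighbour:
  assumes d: "distinct p" and m: "3 \<le> length p" and i: "i < length p"
    and e: "{p ! (Suc i mod length p), v} \<in> edges (graph_of_list p)" "v \<noteq> p ! i"
  shows "v = p ! (Suc (Suc i mod length p) mod length p)"
proof -
  let ?m = "length p"
  have lt: "Suc j mod ?m < ?m" for j using m by (intro mod_less_divisor) linarith
  obtain a where a: "a < ?m" "{p ! (Suc i mod ?m), v} = {p ! a, p ! (Suc a mod ?m)}"
    using e(1) by (auto simp: graph_of_list_def)
  consider "p ! (Suc i mod ?m) = p ! a" "v = p ! (Suc a mod ?m)"
    | "p ! (Suc i mod ?m) = p ! (Suc a mod ?m)" "v = p ! a"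
    using a(2) by (auto simp: doubleton_eq_iff)
  then show ?thesis
  proof cases
    case 1
    then have "a = Suc i mod ?m" using d a(1) lt nth_eq_iff_index_eq by metis
    then show ?thesis using 1 by simp
  next
    case 2
    then have "Suc i mod ?m = Suc a mod ?m" using d lt nth_eq_iff_index_eq by metis
    then have "i = a" using i a(1) m by (auto simp: mod_Suc split: if_splits)
    then show ?thesis using 2 e(2) by simp
  qed
qed

text \<open>
  Walking around a cycle, each further vertex is determined by the two preceding ones.
\<close>
lemma graph_of_list_inj:
  assumes p: "distinct p" and q: "distinct q" "length q = length p" and m: "3 \<le> length p"
    and eq: "graph_of_list q = graph_of_list p" "q ! 0 = p ! 0" "q ! 1 = p ! 1"
  shows "q = p"
proof (rule nth_equalityI[OF q(2)])
  have "Suc i < length p \<Longrightarrow> q ! i = p ! i \<and> q ! Suc i = p ! Suc i" for i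
  proof (induction i)
    case 0
    then show ?case using eq by simp
  next
    case (Suc i)
    then have IH: "q ! i = p ! i" "q ! Suc i = p ! Suc i" by auto
    have m1: "Suc i mod length p = Suc i" "Suc (Suc i) mod length p = Suc (Suc i)" using Suc.prems by auto
    have "{q ! Suc i, q ! Suc (Suc i)} \<in> edges (graph_of_list q)"
      using Suc.prems q(2) by (auto simp: graph_of_list_def intro!: exI[of _ "Suc i"])
    then have "{p ! (Suc i mod length p), q ! Suc (Suc i)} \<in> edges (graph_of_list p)"
      using eq(1) IH m1 by simp
    moreover have "q ! Suc (Suc i) \<noteq> p ! i"
      using IH(1) q Suc.prems by (metis Suc_lessD lessI less_SucI nth_eq_iff_index_eq less_irrefl)
    ultimately have "q ! Suc (Suc i) = p ! (Suc (Suc i mod length p) mod length p)"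
      by (intro graph_of_list_neighbour[OF p m]) (use Suc.prems in auto)
    then show ?case using IH m1 by simp
  qed
  then show "q ! i = p ! i" if "i < length q" for i
    using that q(2) m by (cases i) auto
qed

text \<open>
  Reading off the first two vertices is a bijection from these lists to the $2m$ oriented edges of the
  cycle.
\<close>
lemma card_lists_of_cycle:
  assumes p: "cycle_list (adj G) p" "length p = m" and m: "3 \<le> m"
  shows "card {q. cycle_list (adj G) q \<and> length q = m \<and> graph_of_list q = graph_of_list p} = 2 * m"
proof -
  let ?S = "graph_of_list p"
  let ?F = "{q. cycle_list (adj G) q \<and> length q = m \<and> graph_of_list q = ?S}"
  let ?a = "\<lambda>i. (p ! i, p ! (Suc i mod m))" and ?b = "\<lambda>i. (p ! (Suc i mod m), p ! i)"
  have d: "distinct p" using p(1) by (simp add: cycle_list_def)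
  have lt: "Suc i mod m < m" for i using m by simp
  have nth_inj: "p ! i = p ! j \<longleftrightarrow> i = j" if "i < m" "j < m" for i j
    using that d p(2) by (simp add: nth_eq_iff_index_eq)
  have ends: "(\<lambda>q. (q ! 0, q ! 1)) ` ?F = ?a ` {..<m} \<union> ?b ` {..<m}"
  proof
    show "(\<lambda>q. (q ! 0, q ! 1)) ` ?F \<subseteq> ?a ` {..<m} \<union> ?b ` {..<m}"
    proof
      fix z assume "z \<in> (\<lambda>q. (q ! 0, q ! 1)) ` ?F"
      then obtain q where q: "z = (q ! 0, q ! 1)" "length q = m" "graph_of_list q = ?S" by auto
      have "{q ! 0, q ! (Suc 0 mod length q)} \<in> edges (graph_of_list q)"
        using q(2) m unfolding graph_of_list_def by auto
      then have "{q ! 0, q ! 1} \<in> edges (graph_of_list p)" using q(2,3) m by simp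
      then obtain i where "i < m" "{q ! 0, q ! 1} = {p ! i, p ! (Suc i mod m)}"
        using p(2) by (auto simp: graph_of_list_def)
      then show "z \<in> ?a ` {..<m} \<union> ?b ` {..<m}" using q(1) by (auto simp: doubleton_eq_iff)
    qed
    have "?a i \<in> (\<lambda>q. (q ! 0, q ! 1)) ` ?F" "?b i \<in> (\<lambda>q. (q ! 0, q ! 1)) ` ?F" if i: "i < m" for i
    proof -
      let ?q = "rotate i p"
      have q: "cycle_list (adj G) ?q" "length ?q = m" "graph_of_list ?q = ?S"
        using p i by (auto intro: cycle_list_rotate graph_of_list_rotate)
      have q01: "?q ! 0 = p ! i" "?q ! 1 = p ! (Suc i mod m)"
        using p(2) m i by (simp_all add: nth_rotate)
      then show "?a i \<in> (\<lambda>q. (q ! 0, q ! 1)) ` ?F" using q by (intro image_eqI[of _ _ ?q]) auto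
      \<comment> \<open>Reversal puts the first two vertices of \<open>?q\<close>, exchanged, at the end; rotation returns them to the front.\<close>
      let ?r = "rotate (m - 2) (rev ?q)"
      have r: "graph_of_list ?r = ?S"
        using q(2,3) graph_of_list_rotate[of "m - 2" "rev ?q"] graph_of_list_rev[of ?q] by simp
      moreover have "cycle_list (adj G) ?r"
        using q(1) r p(1) unfolding cycle_list_adj_iff by auto
      moreover have "?r ! 0 = ?q ! 1" "?r ! 1 = ?q ! 0"
        using q(2) m by (simp_all add: nth_rotate rev_nth)
      ultimately show "?b i \<in> (\<lambda>q. (q ! 0, q ! 1)) ` ?F"
        using q(2) q01 by (intro image_eqI[of _ _ ?r]) auto
    qed
    then show "?a ` {..<m} \<union> ?b ` {..<m} \<subseteq> (\<lambda>q. (q ! 0, q ! 1)) ` ?F" by blast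
  qed
  have "inj_on (\<lambda>q. (q ! 0, q ! 1)) ?F"
  proof (rule inj_onI)
    fix q r assume q: "q \<in> ?F" and r: "r \<in> ?F" and eq: "(q ! 0, q ! 1) = (r ! 0, r ! 1)"
    show "q = r"
      by (rule graph_of_list_inj) (use q r eq m in \<open>auto simp: cycle_list_def\<close>)
  qed
  then have "card ?F = card (?a ` {..<m} \<union> ?b ` {..<m})"
    unfolding ends[symmetric] by (simp add: card_image)
  also have "\<dots> = card (?a ` {..<m}) + card (?b ` {..<m})"
  proof (rule card_Un_disjoint)
    have "?a i \<noteq> ?b j" if "i < m" "j < m" for i j
      using that lt nth_inj Suc_mod_neq[OF m] by auto
    then show "?a ` {..<m} \<inter> ?b ` {..<m} = {}" by blast
  qed auto
  also have "\<dots> = 2 * m"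
    using nth_inj by (subst (1 2) card_image) (auto intro!: inj_onI)
  finally show ?thesis .
qed

lemma card_cycles_eq:
  assumes G: "simple_graph G" and m: "3 \<le> m"
  shows "card (fin_graph.cycles (adj G) m) = 2 * m * num_copies (cycle_graph m) G"
proof -
  interpret fin_graph "verts G" "adj G" by (rule fin_graph_adj[OF G])
  let ?C = "copies (cycle_graph m) G" and ?F = "\<lambda>S. {q. cycle_list (adj G) q \<and> length q = m \<and> graph_of_list q = S}"
  have "?C \<subseteq> graph_of_list ` cycles m"
    using copy_is_graph_of_list[OF _ m] by (fastforce simp: cycles_def)
  then have finC: "finite ?C" using finite_cycles finite_surj by blast
  have "cycles m = (\<Union>S\<in>?C. ?F S)"
    using graph_of_list_copy[OF G _ _ m] by (auto simp: cycles_def)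
  then have "card (cycles m) = (\<Sum>S\<in>?C. card (?F S))"
  proof (simp only:, intro card_UN_disjoint)
    show "\<forall>S\<in>?C. finite (?F S)"
    proof
      fix S
      show "finite (?F S)" by (rule finite_subset[OF _ finite_cycles[of m]]) (auto simp: cycles_def)
    qed
  qed (use finC in auto)
  also have "\<dots> = (\<Sum>S\<in>?C. 2 * m)"
  proof (rule sum.cong)
    fix S assume "S \<in> ?C"
    then obtain p where "cycle_list (adj G) p" "length p = m" "graph_of_list p = S"
      using copy_is_graph_of_list[OF _ m] by blast
    then show "card (?F S) = 2 * m" using card_lists_of_cycle[of G p m] m by blast
  qed simp
  finally show ?thesis by (simp add: num_copies_def)
qed

lemma free_of_cycle_graph_iff:
  assumes G: "simple_graph G" and m: "3 \<le> m"
  shows "free_of (cycle_graph m) G \<longleftrightarrow> (\<forall>p. cycle_list (adj G) p \<longrightarrow> length p \<noteq> m)"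
  using graph_of_list_copy[OF G _ _ m] copy_is_graph_of_list[OF _ m] unfolding free_of_def by blast

lemma cycle_free_graph_adj:
  assumes "simple_graph G" "free_of (cycle_graph (2 * k)) G" "3 \<le> k"
  shows "cycle_free_graph (verts G) (adj G) k"
proof -
  interpret fin_graph "verts G" "adj G" by (rule fin_graph_adj[OF assms(1)])
  show ?thesis
    by unfold_locales (use assms free_of_cycle_graph_iff[OF assms(1), of "2 * k"] in auto)
qed

section \<open>The extremal graph and the limit\<close>

lemma filter_splice:
  assumes "length xs = length ys" "set xs \<subseteq> A" "set ys \<inter> A = {}"
  shows "filter (\<lambda>x. x \<in> A) (splice xs ys) = xs" "filter (\<lambda>x. x \<notin> A) (splice xs ys) = ys"
  using assms by (induction xs ys rule: list_induct2) auto

lemma card_distinct_lists: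
  assumes "finite A" "l \<le> card A"
  shows "real (card {xs. length xs = l \<and> distinct xs \<and> set xs \<subseteq> A}) = falling_factorial (real (card A)) l"
proof -
  have "\<Prod>{card A - l + 1..card A} = (\<Prod>i<l. card A - i)"
    by (rule prod.reindex_bij_witness[of _ "\<lambda>i. card A - i" "\<lambda>i. card A - i"]) (use assms(2) in auto)
  then have "real (card {xs. length xs = l \<and> distinct xs \<and> set xs \<subseteq> A}) = real (\<Prod>i<l. card A - i)"
    by (simp only: card_lists_distinct_length_eq[OF assms])
  also have "\<dots> = (\<Prod>i<l. real (card A) - real i)"
    unfolding of_nat_prod by (rule prod.cong) (use assms(2) in auto)
  finally show ?thesis by (simp add: falling_factorial_def)
qed

definition complete_bipartite :: "nat \<Rightarrow> nat \<Rightarrow> nat graph" where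
  "complete_bipartite a n = Graph {..<n} {{x, y} | x y. x < a \<and> a \<le> y \<and> y < n}"

lemma adj_complete_bipartite:
  "adj (complete_bipartite a n) x y \<longleftrightarrow> x < a \<and> a \<le> y \<and> y < n \<or> y < a \<and> a \<le> x \<and> x < n"
  by (auto simp: adj_def complete_bipartite_def doubleton_eq_iff)

lemma simple_complete_bipartite: "simple_graph (complete_bipartite a n)"
  unfolding simple_graph_def complete_bipartite_def by (auto simp: card_insert_if)

lemma free_complete_bipartite:
  assumes "2 \<le> k"
  shows "free_of (cycle_graph (2 * k)) (complete_bipartite (k - 1) n)"
proof -
  let ?E = "adj (complete_bipartite (k - 1) n)"
  have split: "x \<in> {..<k - 1} \<longleftrightarrow> y \<notin> {..<k - 1}" if "?E x y" for x y
    using that by (auto simp: adj_complete_bipartite)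
  have no: "length p \<noteq> 2 * k" if p: "cycle_list ?E p" "hd p < k - 1" for p
  proof
    assume len: "length p = 2 * k"
    have "successively ?E p" "distinct p" using p by (auto simp: cycle_list_def successively_append_iff)
    then obtain xs ys where xy: "p = splice xs ys" "length p = 2 * length xs" "set xs \<subseteq> {..<k - 1}"
      using splice_alternating[of ?E "{..<k - 1}" p, OF split] p(2) len by auto
    have "distinct xs" using \<open>distinct p\<close> xy(1) by (simp add: distinct_splice)
    then have "card (set xs) = k" using xy(2) len by (simp add: distinct_card)
    moreover have "card (set xs) \<le> k - 1" using card_mono[OF _ xy(3)] by simp
    ultimately show False using assms by simp
  qed
  have "length p \<noteq> 2 * k" if p: "cycle_list ?E p" for p
  proof
    assume len: "length p = 2 * k"
    obtain x y q where eq: "p = x # y # q" using len assms by (cases p; cases "tl p"; auto)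
    have "?E x y" using p eq by (simp add: cycle_list_def)
    then have "x < k - 1 \<or> y < k - 1" using split by auto
    then show False
    proof
      assume "x < k - 1"
      then show False using no[OF p] len eq by simp
    next
      assume "y < k - 1"
      then show False using no[OF cycle_list_rotate1[OF p]] len eq by simp
    qed
  qed
  then show ?thesis
    using free_of_cycle_graph_iff[OF simple_complete_bipartite, of "2 * k"] assms by auto
qed

lemma successively_splice:
  assumes "\<And>x y. x \<in> A \<Longrightarrow> y \<in> B \<Longrightarrow> E x y \<and> E y x" "z \<in> A"
    and "length xs = length ys" "set xs \<subseteq> A" "set ys \<subseteq> B"
  shows "successively E (splice xs ys @ [z])"
  using assms(3-)
proof (induction xs ys rule: list_induct2)
  case (Cons x xs y ys)
  have "hd (splice xs ys @ [z]) \<in> A"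
    using Cons \<open>z \<in> A\<close> by (cases xs) auto
  then show ?case using Cons assms(1) by (auto simp: successively_Cons)
qed simp

lemma cycle_list_splice:
  assumes "\<And>x y. x \<in> A \<Longrightarrow> y \<in> B \<Longrightarrow> E x y \<and> E y x" "A \<inter> B = {}"
    and "length xs = l" "length ys = l" "0 < l" "set xs \<subseteq> A" "set ys \<subseteq> B" "distinct xs" "distinct ys"
  shows "cycle_list E (splice xs ys)" "hd (splice xs ys) \<in> A"
proof -
  show hd: "hd (splice xs ys) \<in> A" using assms(3,5,6) by (cases xs) auto
  have "successively E (splice xs ys @ [hd (splice xs ys)])"
    by (rule successively_splice[of A B]) (use assms hd in auto)
  moreover have "distinct (splice xs ys)" using assms by (auto simp: distinct_splice)
  moreover have "splice xs ys \<noteq> []" using assms(3,5) by auto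
  ultimately show "cycle_list E (splice xs ys)" by (simp add: cycle_list_def)
qed

text \<open>
  Interleaving distinct lists from the two classes, in either order, gives distinct cycle lists.
\<close>
lemma card_cycles_complete_bipartite:
  assumes l: "0 < l" "l \<le> a" "a + l \<le> n"
  shows "2 * (falling_factorial (real a) l * falling_factorial (real (n - a)) l)
    \<le> real (card (fin_graph.cycles (adj (complete_bipartite a n)) (2 * l)))"
proof -
  let ?E = "adj (complete_bipartite a n)"
  interpret fin_graph "verts (complete_bipartite a n)" ?E
    by (rule fin_graph_adj[OF simple_complete_bipartite])
  let ?A = "{..<a}" and ?B = "{a..<n}"
  define LA where "LA = {xs. length xs = l \<and> distinct xs \<and> set xs \<subseteq> ?A}"
  define LB where "LB = {xs. length xs = l \<and> distinct xs \<and> set xs \<subseteq> ?B}"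
  have cards: "real (card LA) = falling_factorial (real a) l" "real (card LB) = falling_factorial (real (n - a)) l"
    unfolding LA_def LB_def using l by (simp_all add: card_distinct_lists)
  have inj: "inj_on (\<lambda>(xs, ys). splice xs ys) (LX \<times> LY)"
    if "LX \<subseteq> {xs. length xs = l \<and> set xs \<subseteq> A}" "LY \<subseteq> {xs. length xs = l \<and> set xs \<inter> A = {}}"
    for LX LY :: "nat list set" and A
  proof (rule inj_onI, clarify)
    fix xs ys xs' ys'
    assume *: "xs \<in> LX" "ys \<in> LY" "xs' \<in> LX" "ys' \<in> LY" and eq: "splice xs ys = splice xs' ys'"
    have "length xs = length ys" "set xs \<subseteq> A" "set ys \<inter> A = {}"
      "length xs' = length ys'" "set xs' \<subseteq> A" "set ys' \<inter> A = {}" using * that by auto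
    then show "xs = xs' \<and> ys = ys'" using eq filter_splice by metis
  qed
  define C1 where "C1 = (\<lambda>(xs, ys). splice xs ys) ` (LA \<times> LB)"
  define C2 where "C2 = (\<lambda>(xs, ys). splice xs ys) ` (LB \<times> LA)"
  have adjAB: "?E x y \<and> ?E y x" if "x \<in> ?A" "y \<in> ?B" for x y
    using that by (auto simp: adj_complete_bipartite)
  have adjBA: "?E x y \<and> ?E y x" if "x \<in> ?B" "y \<in> ?A" for x y
    using that by (auto simp: adj_complete_bipartite)
  have C1: "C1 \<subseteq> {p \<in> cycles (2 * l). hd p \<in> ?A}"
  proof
    fix p assume "p \<in> C1"
    then obtain xs ys where p: "p = splice xs ys" "xs \<in> LA" "ys \<in> LB" by (auto simp: C1_def)
    then have *: "length xs = l" "length ys = l" "set xs \<subseteq> ?A" "set ys \<subseteq> ?B" "distinct xs" "distinct ys"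
      by (simp_all add: LA_def LB_def)
    have "?A \<inter> ?B = {}" by auto
    from cycle_list_splice[of ?A ?B ?E, OF adjAB this *(1,2) l(1) *(3-6)]
    show "p \<in> {p \<in> cycles (2 * l). hd p \<in> ?A}" using *(1,2) by (simp add: p(1) cycles_def)
  qed
  have C2: "C2 \<subseteq> {p \<in> cycles (2 * l). hd p \<in> ?B}"
  proof
    fix p assume "p \<in> C2"
    then obtain xs ys where p: "p = splice xs ys" "xs \<in> LB" "ys \<in> LA" by (auto simp: C2_def)
    then have *: "length xs = l" "length ys = l" "set xs \<subseteq> ?B" "set ys \<subseteq> ?A" "distinct xs" "distinct ys"
      by (simp_all add: LA_def LB_def)
    have "?B \<inter> ?A = {}" by auto
    from cycle_list_splice[of ?B ?A ?E, OF adjBA this *(1,2) l(1) *(3-6)]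
    show "p \<in> {p \<in> cycles (2 * l). hd p \<in> ?B}" using *(1,2) by (simp add: p(1) cycles_def)
  qed
  have "inj_on (\<lambda>(xs, ys). splice xs ys) (LA \<times> LB)"
    by (rule inj[of LA ?A LB]) (auto simp: LA_def LB_def)
  then have c1: "card C1 = card LA * card LB"
    unfolding C1_def by (simp add: card_image card_cartesian_product)
  have "inj_on (\<lambda>(xs, ys). splice xs ys) (LB \<times> LA)"
    by (rule inj[of LB ?B LA]) (auto simp: LA_def LB_def)
  then have c2: "card C2 = card LB * card LA"
    unfolding C2_def by (simp add: card_image card_cartesian_product)
  have sub: "C1 \<subseteq> cycles (2 * l)" "C2 \<subseteq> cycles (2 * l)" using C1 C2 by blast+
  have "card (C1 \<union> C2) = card C1 + card C2"
  proof (rule card_Un_disjoint)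
    show "finite C1" "finite C2" using finite_subset[OF sub(1) finite_cycles] finite_subset[OF sub(2) finite_cycles] .
    show "C1 \<inter> C2 = {}"
    proof (rule equals0I)
      fix p assume "p \<in> C1 \<inter> C2"
      then have "hd p \<in> ?A" "hd p \<in> ?B" using C1 C2 by blast+
      then show False by simp
    qed
  qed
  moreover have "card (C1 \<union> C2) \<le> card (cycles (2 * l))"
    using sub by (intro card_mono finite_cycles) blast
  ultimately have "2 * (card LA * card LB) \<le> card (cycles (2 * l))" by (simp add: c1 c2 mult.commute)
  then have "real (2 * (card LA * card LB)) \<le> real (card (cycles (2 * l)))" by (rule of_nat_mono)
  then show ?thesis by (simp add: cards)
qed

text \<open>
  The counts are bounded by $n^m$ and the edgeless graph is admissible, so the maximum exists.
\<close>
lemma gen_turan_witness: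
  assumes m: "3 \<le> m" "3 \<le> r"
  shows "\<exists>G :: nat graph. simple_graph G \<and> card (verts G) = n \<and> free_of (cycle_graph r) G \<and>
      gen_turan n (cycle_graph m) (cycle_graph r) = num_copies (cycle_graph m) G" (is ?ex)
    and "\<And>G :: nat graph. simple_graph G \<Longrightarrow> card (verts G) = n \<Longrightarrow> free_of (cycle_graph r) G \<Longrightarrow>
      num_copies (cycle_graph m) G \<le> gen_turan n (cycle_graph m) (cycle_graph r)"
proof -
  let ?N = "{num_copies (cycle_graph m) G | G :: nat graph.
    simple_graph G \<and> card (verts G) = n \<and> free_of (cycle_graph r) G}"
  have "?N \<subseteq> {..n ^ m}"
  proof
    fix c assume "c \<in> ?N"
    then obtain G :: "nat graph" where G: "simple_graph G" "card (verts G) = n" "c = num_copies (cycle_graph m) G"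
      by blast
    interpret fin_graph "verts G" "adj G" by (rule fin_graph_adj[OF G(1)])
    have "num_copies (cycle_graph m) G \<le> 2 * m * num_copies (cycle_graph m) G" using m by simp
    also have "\<dots> \<le> card (verts G) ^ m"
      using card_cycles_le[of m] card_cycles_eq[OF G(1) m(1)] by simp
    finally show "c \<in> {..n ^ m}" using G by simp
  qed
  then have fin: "finite ?N" by (rule finite_subset) simp
  let ?G0 = "Graph {..<n} {} :: nat graph"
  have G0: "simple_graph ?G0" by (simp add: simple_graph_def)
  have "\<not> cycle_list (adj ?G0) p" for p :: "nat list"
    by (auto simp: cycle_list_nth adj_def)
  then have "free_of (cycle_graph r) ?G0" using free_of_cycle_graph_iff[OF G0 m(2)] by blast
  then have "num_copies (cycle_graph m) ?G0 \<in> ?N" using G0 by force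
  then have "Max ?N \<in> ?N" using fin by (intro Max_in) auto
  then show ?ex unfolding gen_turan_def by auto
  fix G :: "nat graph"
  assume "simple_graph G" "card (verts G) = n" "free_of (cycle_graph r) G"
  then show "num_copies (cycle_graph m) G \<le> gen_turan n (cycle_graph m) (cycle_graph r)"
    unfolding gen_turan_def using fin by (intro Max_ge) auto
qed

lemma gen_turan_upper:
  assumes l: "2 \<le> l" "l < k" and \<eta>: "0 < \<eta>"
  shows "\<exists>n0. \<forall>n\<ge>n0. real (gen_turan n (cycle_graph (2 * l)) (cycle_graph (2 * k)))
    \<le> (falling_factorial (real k - 1) l / (2 * real l) + \<eta>) * real n ^ l"
proof -
  let ?F = "falling_factorial (real k - 1) l"
  have F: "real (card {xs. length xs = l \<and> distinct xs \<and> set xs \<subseteq> {..<k - 1}}) = ?F"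
    using card_distinct_lists[of "{..<k - 1}" l] l by simp
  have "0 < 4 * real l * \<eta>" using l \<eta> by simp
  from eventually_few_cycles[OF l this] obtain n0 where n0:
    "\<And>(V :: nat set) E. cycle_free_graph V E k \<Longrightarrow> n0 \<le> card V \<Longrightarrow>
      real (card (fin_graph.cycles E (2 * l))) \<le> (2 * ?F + 4 * real l * \<eta>) * real (card V) ^ l"
    unfolding F by blast
  show ?thesis
  proof (intro exI allI impI)
    fix n assume n: "n0 \<le> n"
    obtain G :: "nat graph" where G: "simple_graph G" "card (verts G) = n" "free_of (cycle_graph (2 * k)) G"
      "gen_turan n (cycle_graph (2 * l)) (cycle_graph (2 * k)) = num_copies (cycle_graph (2 * l)) G"
      using gen_turan_witness(1)[of "2 * l" "2 * k" n] l by auto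
    have "cycle_free_graph (verts G) (adj G) k"
      by (rule cycle_free_graph_adj[OF G(1,3)]) (use l in simp)
    from n0[OF this] have "real (card (fin_graph.cycles (adj G) (2 * l))) \<le> (2 * ?F + 4 * real l * \<eta>) * real n ^ l"
      using G(2) n by simp
    moreover have "card (fin_graph.cycles (adj G) (2 * l)) = 2 * (2 * l) * num_copies (cycle_graph (2 * l)) G"
      by (rule card_cycles_eq[OF G(1)]) (use l in simp)
    ultimately have "4 * real l * real (num_copies (cycle_graph (2 * l)) G) \<le> (2 * ?F + 4 * real l * \<eta>) * real n ^ l"
      by simp
    also have "2 * ?F + 4 * real l * \<eta> = 4 * real l * (?F / (2 * real l) + \<eta>)"
      using l by (simp add: field_simps)
    finally have "4 * real l * real (num_copies (cycle_graph (2 * l)) G)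
        \<le> 4 * real l * ((?F / (2 * real l) + \<eta>) * real n ^ l)"
      by (simp only: mult.assoc)
    then have "real (num_copies (cycle_graph (2 * l)) G) \<le> (?F / (2 * real l) + \<eta>) * real n ^ l"
      using l by (simp only: mult_le_cancel_left_pos)
    then show "real (gen_turan n (cycle_graph (2 * l)) (cycle_graph (2 * k))) \<le> (?F / (2 * real l) + \<eta>) * real n ^ l"
      by (simp only: G(4))
  qed
qed

lemma gen_turan_lower:
  assumes l: "2 \<le> l" "l < k" and n: "k + l \<le> n"
  shows "falling_factorial (real k - 1) l / (2 * real l) * falling_factorial (real (n - (k - 1))) l
    \<le> real (gen_turan n (cycle_graph (2 * l)) (cycle_graph (2 * k)))"
proof -
  let ?K = "complete_bipartite (k - 1) n" and ?F = "falling_factorial (real k - 1) l"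
  have "num_copies (cycle_graph (2 * l)) ?K \<le> gen_turan n (cycle_graph (2 * l)) (cycle_graph (2 * k))"
    by (rule gen_turan_witness(2))
      (use l simple_complete_bipartite free_complete_bipartite[of k n] in \<open>auto simp: complete_bipartite_def\<close>)
  moreover have "2 * (?F * falling_factorial (real (n - (k - 1))) l)
      \<le> real (card (fin_graph.cycles (adj ?K) (2 * l)))"
    using card_cycles_complete_bipartite[of l "k - 1" n] l n by simp
  moreover have "card (fin_graph.cycles (adj ?K) (2 * l)) = 2 * (2 * l) * num_copies (cycle_graph (2 * l)) ?K"
    by (rule card_cycles_eq[OF simple_complete_bipartite]) (use l in simp)
  ultimately have "2 * (?F * falling_factorial (real (n - (k - 1))) l)
      \<le> 4 * real l * real (num_copies (cycle_graph (2 * l)) ?K)"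
    and "4 * real l * real (num_copies (cycle_graph (2 * l)) ?K)
      \<le> 4 * real l * real (gen_turan n (cycle_graph (2 * l)) (cycle_graph (2 * k)))"
    by (simp_all add: mult_left_mono)
  then have "2 * (?F * falling_factorial (real (n - (k - 1))) l)
      \<le> 4 * real l * real (gen_turan n (cycle_graph (2 * l)) (cycle_graph (2 * k)))"
    by (rule order_trans)
  then show ?thesis using l by (simp add: field_simps)
qed

text \<open>
  The number of choices in the large class is asymptotically $n^\ell$.
\<close>
lemma falling_factorial_asymp: "(\<lambda>n. falling_factorial (real (n - a)) l / real n ^ l) \<longlonglongrightarrow> 1"
proof -
  have "(\<lambda>n. \<Prod>i<l. 1 - (real a + real i) / real n) \<longlonglongrightarrow> (\<Prod>i<l. 1 - 0)"
    by (intro tendsto_prod tendsto_diff tendsto_const lim_const_over_n)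
  moreover have "eventually (\<lambda>n. (\<Prod>i<l. 1 - (real a + real i) / real n) = falling_factorial (real (n - a)) l / real n ^ l) sequentially"
    using eventually_ge_at_top[of "Suc a"]
  proof eventually_elim
    case (elim n)
    have "(\<Prod>i<l. 1 - (real a + real i) / real n) = (\<Prod>i<l. (real (n - a) - real i) / real n)"
      by (rule prod.cong) (use elim in \<open>auto simp: field_simps\<close>)
    also have "\<dots> = falling_factorial (real (n - a)) l / real n ^ l"
      by (simp add: prod_dividef falling_factorial_def)
    finally show ?case .
  qed
  ultimately show ?thesis by (simp add: tendsto_cong)
qed

theorem theorem1p4:
  fixes k l :: nat
  assumes "l \<ge> 2" and "k > l"
  shows "\<exists>\<epsilon> :: nat \<Rightarrow> real. \<epsilon> \<longlonglongrightarrow> 0 \<and>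
    (\<forall>n. real (gen_turan n (cycle_graph (2 * l)) (cycle_graph (2 * k))) =
          (falling_factorial (real k - 1) l / (2 * real l) + \<epsilon> n) * real n ^ l)"
proof -
  let ?g = "\<lambda>n. real (gen_turan n (cycle_graph (2 * l)) (cycle_graph (2 * k)))"
  define c where "c = falling_factorial (real k - 1) l / (2 * real l)"
  define \<epsilon> where "\<epsilon> n = ?g n / real n ^ l - c" for n
  \<comment> \<open>For $n = 0$ the right-hand side vanishes whatever the error term is.\<close>
  have "?g 0 = 0"
  proof -
    obtain G :: "nat graph" where G: "simple_graph G" "card (verts G) = 0"
      "gen_turan 0 (cycle_graph (2 * l)) (cycle_graph (2 * k)) = num_copies (cycle_graph (2 * l)) G"
      using gen_turan_witness(1)[of "2 * l" "2 * k" 0] assms by auto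
    interpret fin_graph "verts G" "adj G" by (rule fin_graph_adj[OF G(1)])
    have "2 * (2 * l) * num_copies (cycle_graph (2 * l)) G = card (cycles (2 * l))"
      by (rule card_cycles_eq[OF G(1), symmetric]) (use assms in simp)
    also have "\<dots> \<le> 0 ^ (2 * l)" using card_cycles_le[of "2 * l"] unfolding G(2) .
    finally have "num_copies (cycle_graph (2 * l)) G = 0" using assms by (simp add: power_0_left)
    then show ?thesis using G(3) by simp
  qed
  then have "?g n = (c + \<epsilon> n) * real n ^ l" for n
    using assms by (cases "n = 0") (simp_all add: \<epsilon>_def)
  moreover have "\<epsilon> \<longlonglongrightarrow> 0"
  proof (rule LIMSEQ_I)
    fix \<eta> :: real assume \<eta>: "0 < \<eta>"
    from gen_turan_upper[of l k "\<eta> / 2"] obtain n0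
      where n0: "\<And>n. n0 \<le> n \<Longrightarrow> ?g n \<le> (c + \<eta> / 2) * real n ^ l" using assms \<eta> unfolding c_def by auto
    have "(\<lambda>n. c * (falling_factorial (real (n - (k - 1))) l / real n ^ l)) \<longlonglongrightarrow> c * 1"
      by (intro tendsto_mult tendsto_const falling_factorial_asymp)
    from LIMSEQ_D[OF this \<eta>] obtain n1
      where n1: "\<And>n. n1 \<le> n \<Longrightarrow> \<bar>c * (falling_factorial (real (n - (k - 1))) l / real n ^ l) - c\<bar> < \<eta>" by auto
    have "\<bar>\<epsilon> n\<bar> < \<eta>" if n: "n0 + n1 + k + l \<le> n" for n
    proof -
      have pos: "0 < real n ^ l" using n assms by simp
      have "?g n / real n ^ l \<le> c + \<eta> / 2" using n0[of n] n pos by (simp add: field_simps)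
      moreover have "c * (falling_factorial (real (n - (k - 1))) l / real n ^ l) \<le> ?g n / real n ^ l"
        using divide_right_mono[OF gen_turan_lower[of l k n], of "real n ^ l"] n assms by (simp add: c_def)
      moreover have "\<bar>c * (falling_factorial (real (n - (k - 1))) l / real n ^ l) - c\<bar> < \<eta>"
        using n1[of n] n by simp
      ultimately show ?thesis unfolding \<epsilon>_def using \<eta> by linarith
    qed
    then show "\<exists>no. \<forall>n\<ge>no. norm (\<epsilon> n - 0) < \<eta>" by (intro exI[of _ "n0 + n1 + k + l"]) auto
  qed
  ultimately show ?thesis unfolding c_def by blast
qed

end
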